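(* Let $\rho(t)$, $t\ge0$, be a density operator on a finite-dimensional complex Hilbert space evolving by the Lindblad equation $$\dot\rho(t)=-i[H,\rho(t)]+\sum_{m=1}^{N_C}\left(L_m\rho(t)L_m^\dagger-\tfrac12\{L_m^\dagger L_m,\rho(t)\}\right),$$ with time-independent hermitian Hamiltonian $H$ and time-independent jump operators $L_1,\dots,L_{N_C}$. Assume that for each $m$ there is a real number $\omega_m$ with $[L_m,H]=\omega_mL_m$. Let $\mathcal{A}(t)$ be the classical dynamical activity, let $V(t):=e^{-iHt}$, and let $\tau>0$ be such that $0<\frac12\int_0^\tau\frac{\sqrt{\mathcal{A}(t)}}{t}\,dt\le\frac{\pi}{2}$. Then $$\tau\ \ge\ \frac{2\,\mathcal{L}_D\big(\rho(0),V(\tau)^\dagger\rho(\tau)V(\tau)\big)}{\frac1\tau\int_0^\tau\frac{\sqrt{\mathcal{A}(t)}}{t}\,dt}\ \ge\ \frac{2\,\widetilde{\mathcal{L}}_D([\rho(0)],[\rho(\tau)])}{\frac1\tau\int_0^\tau\frac{\sqrt{\mathcal{A}(t)}}{t}\,dt}.$$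
   Context: Units $\hbar=1$. The classical dynamical activity is $\mathcal{A}(t):=\int_0^t\sum_{m=1}^{N_C}\mathrm{Tr}[L_m\rho(s)L_m^\dagger]\,ds$. The Bures angle is $\mathcal{L}_D(\rho,\sigma):=\arccos\sqrt{\mathrm{Fid}(\rho,\sigma)}$ with $\mathrm{Fid}(\rho,\sigma):=\left(\mathrm{Tr}\sqrt{\sqrt\rho\,\sigma\sqrt\rho}\right)^2$. For density operators $\rho,\sigma$ on an $n$-dimensional space with eigenvalue vectors $\mathbf{p},\mathbf{q}$, $\widetilde{\mathcal{L}}_D([\rho],[\sigma]):=\min_{U\text{ unitary}}\mathcal{L}_D(U\rho U^\dagger,\sigma)=\arccos\left(\sum_{i=1}^n\sqrt{p_i^\uparrow q_i^\uparrow}\right)$, where $\uparrow$ denotes arrangement of components in non-descending order and $[\rho]$ is the class of $\rho$ under unitary conjugation. *)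

theory Defs
  imports "HOL-Analysis.Analysis"
begin

type_synonym 'n cmatrix = "complex ^ 'n ^ 'n"

definition cscale :: "complex \<Rightarrow> 'n::finite cmatrix \<Rightarrow> 'n cmatrix" where
  "cscale c A = (\<chi> i j. c * A $ i $ j)"

definition dagger :: "'n::finite cmatrix \<Rightarrow> 'n cmatrix" where
  "dagger A = (\<chi> i j. cnj (A $ j $ i))"

definition hermitian :: "'n::finite cmatrix \<Rightarrow> bool" where
  "hermitian A \<longleftrightarrow> dagger A = A"

definition unitary :: "'n::finite cmatrix \<Rightarrow> bool" where
  "unitary U \<longleftrightarrow> dagger U ** U = mat 1 \<and> U ** dagger U = mat 1"

definition psd :: "'n::finite cmatrix \<Rightarrow> bool" where
  "psd A \<longleftrightarrow> hermitian A \<and> (\<forall>x. 0 \<le> Re (\<Sum>i\<in>UNIV. cnj (x $ i) * (A *v x) $ i))"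

definition density_op :: "'n::finite cmatrix \<Rightarrow> bool" where
  "density_op \<rho> \<longleftrightarrow> psd \<rho> \<and> trace \<rho> = 1"

definition commutator :: "'n::finite cmatrix \<Rightarrow> 'n cmatrix \<Rightarrow> 'n cmatrix" where
  "commutator A B = A ** B - B ** A"

definition anticommutator :: "'n::finite cmatrix \<Rightarrow> 'n cmatrix \<Rightarrow> 'n cmatrix" where
  "anticommutator A B = A ** B + B ** A"

(* Multiplication in the type class of vectors is componentwise, so neither the class
   power nor the class exponential is the matrix one. *)
primrec mpow :: "'n::finite cmatrix \<Rightarrow> nat \<Rightarrow> 'n cmatrix" where
  "mpow A 0 = mat 1"
| "mpow A (Suc k) = A ** mpow A k"

definition mexp :: "'n::finite cmatrix \<Rightarrow> 'n cmatrix" where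
  "mexp A = (\<Sum>k. (1 / fact k :: real) *\<^sub>R mpow A k)"

(* The positive square root; meaningful for positive semidefinite arguments only. *)
definition msqrt :: "'n::finite cmatrix \<Rightarrow> 'n cmatrix" where
  "msqrt A = (THE S. psd S \<and> S ** S = A)"

(* The trace of a positive semidefinite matrix is real, so Re only changes the type. *)
definition fidelity :: "'n::finite cmatrix \<Rightarrow> 'n cmatrix \<Rightarrow> real" where
  "fidelity \<rho> \<sigma> = (Re (trace (msqrt (msqrt \<rho> ** \<sigma> ** msqrt \<rho>))))\<^sup>2"

definition bures_angle :: "'n::finite cmatrix \<Rightarrow> 'n cmatrix \<Rightarrow> real" where
  "bures_angle \<rho> \<sigma> = arccos (sqrt (fidelity \<rho> \<sigma>))"

(* The minimum over the unitary orbit, as a function of representatives of the classes.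
   Least on the reals is the minimum of the set, and is unspecified if it has none. *)
definition bures_angle_orbit :: "'n::finite cmatrix \<Rightarrow> 'n cmatrix \<Rightarrow> real" where
  "bures_angle_orbit \<rho> \<sigma> =
     (LEAST x. \<exists>U. unitary U \<and> x = bures_angle (U ** \<rho> ** dagger U) \<sigma>)"

definition lindbladian ::
  "'n::finite cmatrix \<Rightarrow> nat \<Rightarrow> (nat \<Rightarrow> 'n cmatrix) \<Rightarrow> 'n cmatrix \<Rightarrow> 'n cmatrix" where
  "lindbladian H N L \<rho> =
     cscale (- \<i>) (commutator H \<rho>)
     + (\<Sum>m=1..N. L m ** \<rho> ** dagger (L m)
         - (1/2 :: real) *\<^sub>R anticommutator (dagger (L m) ** L m) \<rho>)"

(* Re only changes the type: every summand is the trace of a positive semidefinite matrix. *)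
definition activity ::
  "nat \<Rightarrow> (nat \<Rightarrow> 'n::finite cmatrix) \<Rightarrow> (real \<Rightarrow> 'n cmatrix) \<Rightarrow> real \<Rightarrow> real" where
  "activity N L \<rho> t =
     integral {0..t} (\<lambda>s. \<Sum>m=1..N. Re (trace (L m ** \<rho> s ** dagger (L m))))"

definition evolution :: "'n::finite cmatrix \<Rightarrow> real \<Rightarrow> 'n cmatrix" where
  "evolution H t = mexp (cscale (- \<i> * of_real t) H)"

end

theory Submission imports Defs begin

text \<open>Let \<open>K = \<Sum> L\<^sub>m\<^sup>\<dagger> L\<^sub>m\<close>; the commutation relations make it commute with \<open>H\<close>. In the interaction
  picture the state dominates its no-jump part: \<open>V\<^sup>\<dagger> \<rho>(t) V - M \<rho>(0) M\<close> is positive for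
  \<open>M = exp (- t K / 2)\<close>. This has two consequences. The root fidelity of \<open>\<rho>(0)\<close> and
  \<open>V\<^sup>\<dagger> \<rho>(t) V\<close> is at least \<open>g(t) = tr (exp (- t K / 2) \<rho>(0))\<close>, and the activity is at least
  \<open>1 - a(t)\<close> with \<open>a(t) = tr (exp (- t K) \<rho>(0))\<close>. In the spectral measure of \<open>K\<close>, the inequalities
  \<open>x exp (- x / 2) \<le> 1 - exp (- x)\<close> and \<open>g\<^sup>2 \<le> a\<close> give \<open>(arccos g)' \<le> sqrt (1 - a) / (2 t)\<close>, which
  integrates to the bound on the Bures angle. The second bound holds because \<open>V\<close> is one of the
  unitaries in the minimum, which is attained by compactness.\<close>

section \<open>Matrix algebra\<close>

lemma bounded_bilinear_matrix_mult:
  "bounded_bilinear ((**) :: 'n::finite cmatrix \<Rightarrow> 'n cmatrix \<Rightarrow> 'n cmatrix)"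
  unfolding bilinear_conv_bounded_bilinear[symmetric] bilinear_def
  by (auto intro!: linearI
      simp: matrix_matrix_mult_def vec_eq_iff sum.distrib scaleR_sum_right algebra_simps)

interpretation matrix_mult: bounded_bilinear
  "(**) :: 'n::finite cmatrix \<Rightarrow> 'n cmatrix \<Rightarrow> 'n cmatrix"
  by (rule bounded_bilinear_matrix_mult)

lemma bounded_linear_dagger: "bounded_linear (dagger :: 'n::finite cmatrix \<Rightarrow> 'n cmatrix)"
  by (auto intro!: linear_conv_bounded_linear[THEN iffD1] linearI simp: dagger_def vec_eq_iff)

lemma bounded_linear_trace: "bounded_linear (trace :: 'n::finite cmatrix \<Rightarrow> complex)"
  by (auto intro!: linear_conv_bounded_linear[THEN iffD1] linearI
      simp: trace_def sum.distrib scaleR_sum_right)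

lemmas dagger_add = linear_add[OF bounded_linear.linear[OF bounded_linear_dagger]]
  and dagger_diff = linear_diff[OF bounded_linear.linear[OF bounded_linear_dagger]]
  and dagger_scaleR = linear_scale[OF bounded_linear.linear[OF bounded_linear_dagger]]
  and dagger_0 [simp] = linear_0[OF bounded_linear.linear[OF bounded_linear_dagger]]

lemma dagger_nth [simp]: "dagger A $ i $ j = cnj (A $ j $ i)"
  by (simp add: dagger_def)

lemma dagger_dagger [simp]: "dagger (dagger A) = A"
  by (simp add: vec_eq_iff)

lemma dagger_mult: "dagger (A ** B) = dagger B ** dagger A"
  by (simp add: vec_eq_iff matrix_matrix_mult_def mult.commute)

lemma dagger_mat_1 [simp]: "dagger (mat 1) = mat 1"
  by (simp add: vec_eq_iff mat_def)

lemma trace_dagger: "trace (dagger A) = cnj (trace A)"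
  by (simp add: trace_def)

text \<open>The type class product on \<open>complex ^ 'n\<close> is only the real part of this one;
  an orthonormal eigenbasis needs the complex-valued product.\<close>

definition cinner :: "complex ^ 'n::finite \<Rightarrow> complex ^ 'n \<Rightarrow> complex" where
  "cinner x y = (\<Sum>i\<in>UNIV. cnj (x $ i) * y $ i)"

lemma cinner_simps:
  "cinner x (y + z) = cinner x y + cinner x z"
  "cinner x (r *\<^sub>R y) = r *\<^sub>R cinner x y"
  by (simp_all add: cinner_def algebra_simps sum.distrib scaleR_sum_right)

lemma cinner_cnj: "cinner y x = cnj (cinner x y)"
  by (simp add: cinner_def mult.commute)

lemma cinner_matrix_mult: "cinner x (A *v y) = cinner (dagger A *v x) y"
proof -
  have "cinner x (A *v y) = (\<Sum>i\<in>UNIV. \<Sum>j\<in>UNIV. cnj (x $ i) * A $ i $ j * y $ j)"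
    by (simp add: cinner_def matrix_vector_mult_def sum_distrib_left algebra_simps)
  also have "\<dots> = (\<Sum>j\<in>UNIV. \<Sum>i\<in>UNIV. cnj (x $ i) * A $ i $ j * y $ j)"
    by (rule sum.swap)
  also have "\<dots> = cinner (dagger A *v x) y"
    by (simp add: cinner_def matrix_vector_mult_def sum_distrib_left sum_distrib_right mult_ac)
  finally show ?thesis .
qed

lemma inner_eq_Re_cinner: "x \<bullet> y = Re (cinner x y)"
  by (simp add: cinner_def inner_vec_def inner_complex_def)

lemma inner_matrix_mult_left: "x \<bullet> (A *v y) = (dagger A *v x) \<bullet> y"
  by (simp add: inner_eq_Re_cinner cinner_matrix_mult)

lemma cmatrix_vector_mult_scaleR:
  fixes A :: "'n::finite cmatrix"
  shows "A *v (r *\<^sub>R x) = r *\<^sub>R (A *v x)" "(r *\<^sub>R A) *v x = r *\<^sub>R (A *v x)"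
  by (simp_all add: vec_eq_iff matrix_vector_mult_def scaleR_sum_right)

lemma bounded_linear_quadratic_form:
  fixes x :: "complex ^ 'n::finite"
  shows "bounded_linear (\<lambda>S :: 'n cmatrix. x \<bullet> (S *v x))"
  by (auto intro!: linear_conv_bounded_linear[THEN iffD1] linearI
      simp: matrix_vector_mult_add_rdistrib cmatrix_vector_mult_scaleR inner_add_right)

text \<open>The class product of matrices is the real part of the Hilbert-Schmidt product, so
  \<open>norm\<close> is the Frobenius norm and Cauchy-Schwarz applies to traces directly.\<close>

lemma inner_eq_trace: "X \<bullet> Y = Re (trace (dagger X ** Y))" for X Y :: "'n::finite cmatrix"
proof -
  have "X \<bullet> Y = (\<Sum>i\<in>UNIV. \<Sum>j\<in>UNIV. Re (cnj (X $ i $ j) * Y $ i $ j))"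
    by (simp add: inner_vec_def inner_complex_def)
  also have "\<dots> = (\<Sum>j\<in>UNIV. \<Sum>i\<in>UNIV. Re (cnj (X $ i $ j) * Y $ i $ j))"
    by (rule sum.swap)
  also have "\<dots> = Re (trace (dagger X ** Y))"
    by (simp add: trace_def matrix_matrix_mult_def)
  finally show ?thesis .
qed

lemma norm_matrix_square: "(norm X)\<^sup>2 = Re (trace (dagger X ** X))" for X :: "'n::finite cmatrix"
  by (simp add: power2_norm_eq_inner inner_eq_trace)

section \<open>Positive semidefinite matrices\<close>

lemma psd_iff: "psd A \<longleftrightarrow> hermitian A \<and> (\<forall>x. 0 \<le> x \<bullet> (A *v x))"
  by (simp add: psd_def inner_vec_def inner_complex_def)

lemma psdD:
  assumes "psd A"
  shows "hermitian A" "0 \<le> x \<bullet> (A *v x)"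
  using assms by (auto simp: psd_iff)

lemma psd_congruence:
  assumes "psd A"
  shows "psd (X ** A ** dagger X)"
proof -
  have "x \<bullet> (X ** A ** dagger X *v x) = (dagger X *v x) \<bullet> (A *v (dagger X *v x))" for x
    by (metis inner_matrix_mult_left matrix_vector_mul_assoc)
  with assms show ?thesis
    by (auto simp: psd_iff hermitian_def dagger_mult matrix_mul_assoc)
qed

lemma psd_mat_1: "psd (mat 1)"
  by (simp add: psd_iff hermitian_def)

lemma psd_mult_dagger: "psd (X ** dagger X)"
  using psd_congruence[OF psd_mat_1, of X] by simp

lemma psd_dagger_mult: "psd (dagger X ** X)"
  using psd_mult_dagger[of "dagger X"] by simp

lemma psd_0 [simp]: "psd 0"
  by (simp add: psd_iff hermitian_def)

lemma psd_add: "psd A \<Longrightarrow> psd B \<Longrightarrow> psd (A + B)"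
  by (simp add: psd_iff hermitian_def dagger_add matrix_vector_mult_add_rdistrib inner_add_right)

lemma psd_sum: "(\<And>i. i \<in> I \<Longrightarrow> psd (A i)) \<Longrightarrow> psd (\<Sum>i\<in>I. A i)"
  by (induction I rule: infinite_finite_induct) (auto intro: psd_add)

lemma psd_diag:
  assumes "psd A"
  shows "0 \<le> Re (A $ i $ i)"
proof -
  have "(A *v axis i 1) $ i = A $ i $ i"
    by (simp add: matrix_vector_mult_def axis_def if_distrib[of "\<lambda>x. _ * x"] cong: if_cong)
  then have "axis i 1 \<bullet> (A *v axis i 1) = Re (A $ i $ i)"
    by (simp add: inner_axis' inner_complex_def)
  with assms show ?thesis by (metis psdD(2))
qed

lemma psd_trace_nonneg: "psd A \<Longrightarrow> 0 \<le> Re (trace A)"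
  by (auto simp: trace_def intro!: sum_nonneg psd_diag)

text \<open>Moving from \<open>x\<close> along \<open>w = A *v x\<close> by \<open>t\<close> changes
  the form to first order by \<open>2 t (w \<bullet> w)\<close>, which is negative for small
  negative \<open>t\<close> unless \<open>w = 0\<close>. Nonnegativity is asked only on that line,
  so the lemma also serves for a form that is nonnegative merely on an invariant subspace.\<close>

lemma quadratic_form_zero_imp:
  fixes A :: "'n::finite cmatrix"
  assumes herm: "hermitian A" and zero: "x \<bullet> (A *v x) = 0"
    and nonneg: "\<And>t::real. 0 \<le> (x + t *\<^sub>R (A *v x)) \<bullet> (A *v (x + t *\<^sub>R (A *v x)))"
  shows "A *v x = 0"
proof (rule ccontr)
  define w where "w = A *v x"
  define a b where "a = w \<bullet> w" and "b = w \<bullet> (A *v w)"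
  assume "A *v x \<noteq> 0"
  then have "a > 0" by (simp add: a_def w_def)
  have "x \<bullet> (A *v w) = a"
    using inner_matrix_mult_left[of x A w] herm by (simp add: hermitian_def w_def a_def)
  then have ineq: "0 \<le> 2 * (a * t) + t * (t * b)" for t
  proof -
    have "(x + t *\<^sub>R w) \<bullet> (A *v (x + t *\<^sub>R w)) =
        x \<bullet> w + t * (x \<bullet> (A *v w)) + t * (w \<bullet> w) + t * (t * b)"
      unfolding matrix_vector_right_distrib cmatrix_vector_mult_scaleR w_def[symmetric] b_def
        inner_add_left inner_add_right inner_scaleR_left inner_scaleR_right
      by (simp add: distrib_left)
    then show ?thesis
      using nonneg[of t] zero \<open>x \<bullet> (A *v w) = a\<close>
      by (simp add: w_def[symmetric] a_def[symmetric] power2_eq_square)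
  qed
  \<comment> \<open>The size of \<open>t\<close> is chosen so that \<open>t * b\<close> is at most
    \<open>a\<close> in absolute value and cannot outweigh the linear coefficient
    \<open>2 * a\<close>.\<close>
  define t where "t = - a / (\<bar>b\<bar> + 1)"
  have "t < 0" using \<open>a > 0\<close> by (simp add: t_def)
  have "\<bar>t * b\<bar> \<le> a"
    using \<open>a > 0\<close> by (simp add: t_def abs_mult divide_simps)
  then have "2 * a + t * b > 0" using \<open>a > 0\<close> by linarith
  then have "t * (2 * a + t * b) < 0" using \<open>t < 0\<close> by (simp add: mult_neg_pos)
  with ineq[of t] show False by (simp add: power2_eq_square algebra_simps)
qed

lemma psd_quadratic_form_zero: "psd A \<Longrightarrow> x \<bullet> (A *v x) = 0 \<Longrightarrow> A *v x = 0"
  by (rule quadratic_form_zero_imp) (simp_all add: psd_iff)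

lemma trace_conjugation_columns:
  "Re (trace (dagger X ** A ** X)) = (\<Sum>i\<in>UNIV. column i X \<bullet> (A *v column i X))"
proof -
  have "(dagger X ** (A ** X)) $ i $ i = cinner (column i X) (A *v column i X)" for i
    by (simp add: matrix_matrix_mult_def cinner_def matrix_vector_mult_def column_def)
  then show ?thesis
    by (simp add: trace_def inner_eq_Re_cinner matrix_mul_assoc[symmetric])
qed

text \<open>The trace is the sum of the quadratic forms of \<open>A\<close> at the columns of
  \<open>X\<close>. A vanishing sum of nonnegative terms makes each form vanish, hence
  \<open>A\<close> kills every column.\<close>

lemma psd_trace_conjugation_zero:
  assumes "psd A" "Re (trace (dagger X ** A ** X)) = 0"
  shows "A ** X = 0"
proof -
  have "column i X \<bullet> (A *v column i X) = 0" for i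
    using assms by (simp add: trace_conjugation_columns sum_nonneg_eq_0_iff psdD(2))
  then have "A *v column i X = 0" for i
    using assms(1) psd_quadratic_form_zero by blast
  then show ?thesis
    by (simp add: vec_eq_iff matrix_matrix_mult_def matrix_vector_mult_def column_def)
qed

section \<open>Unitary and diagonal matrices\<close>

lemma unitaryD: assumes "unitary U" shows "dagger U ** U = mat 1" "U ** dagger U = mat 1"
  using assms by (auto simp: unitary_def)

lemma unitary_cancel:
  assumes "unitary U"
  shows "A ** dagger U ** U = A" "A ** U ** dagger U = A"
    "dagger U ** (U ** A) = A"
  using unitaryD[OF assms] by (metis matrix_mul_assoc matrix_mul_lid matrix_mul_rid)+

lemma unitary_dagger: "unitary U \<Longrightarrow> unitary (dagger U)"
  by (simp add: unitary_def)

lemma trace_conj_unitary: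
  assumes "unitary U" shows "trace (U ** A ** dagger U) = trace A"
  using unitaryD[OF assms] by (metis matrix_mul_assoc matrix_mul_lid trace_mul_sym)

definition diag_matrix :: "('n::finite \<Rightarrow> complex) \<Rightarrow> 'n cmatrix" where
  "diag_matrix d = (\<chi> i j. if i = j then d i else 0)"

lemma diag_matrix_mult_nth [simp]:
  "(diag_matrix d ** A) $ i $ j = d i * A $ i $ j"
  "(A ** diag_matrix d) $ i $ j = A $ i $ j * d j"
  by (simp_all add: diag_matrix_def matrix_matrix_mult_def if_distrib[of "\<lambda>x. x * _"]
      if_distrib[of "\<lambda>x. _ * x"] cong: if_cong)

lemma diag_matrix_mult: "diag_matrix c ** diag_matrix d = diag_matrix (\<lambda>i. c i * d i)"
  by (simp add: vec_eq_iff) (simp add: diag_matrix_def)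

lemma dagger_diag_matrix: "dagger (diag_matrix d) = diag_matrix (\<lambda>i. cnj (d i))"
  by (simp add: vec_eq_iff) (simp add: diag_matrix_def)

lemma psd_diag_matrix:
  assumes "\<And>i. 0 \<le> d i"
  shows "psd (diag_matrix (\<lambda>i. complex_of_real (d i)))"
proof -
  have "diag_matrix (\<lambda>i. complex_of_real (d i)) =
      diag_matrix (\<lambda>i. of_real (sqrt (d i))) ** dagger (diag_matrix (\<lambda>i. of_real (sqrt (d i))))"
    using assms by (simp add: dagger_diag_matrix diag_matrix_mult flip: of_real_mult)
  then show ?thesis by (metis psd_mult_dagger)
qed

section \<open>The spectral theorem for hermitian matrices\<close>

lemma cinner_eq_inner: "cinner x y = Complex (x \<bullet> y) ((\<i> *s x) \<bullet> y)"
  by (simp add: cinner_def inner_vec_def inner_complex_def complex_eq_iff algebra_simps)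

lemma cinner_self: "cinner x x = of_real ((norm x)\<^sup>2)"
  by (simp add: power2_norm_eq_inner cinner_eq_inner complex_eq_iff)
    (simp add: inner_vec_def inner_complex_def)

text \<open>Complex orthogonality to \<open>v\<close> is real orthogonality to both \<open>v\<close>
  and \<open>\<i> *s v\<close>, so a real dimension count suffices: twice \<open>card S\<close> is
  below the real dimension, twice \<open>CARD('n)\<close>.\<close>

lemma exists_cinner_orthogonal:
  fixes S :: "(complex ^ 'n::finite) set"
  assumes "finite S" "card S < CARD('n)"
  obtains x where "x \<noteq> 0" "\<And>v. v \<in> S \<Longrightarrow> cinner v x = 0"
proof -
  define T where "T = S \<union> (*s) \<i> ` S"
  have "dim T \<le> card T" using assms by (intro dim_le_card) (auto simp: T_def span_superset)
  also have "\<dots> \<le> card S + card S"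
    unfolding T_def by (rule order_trans[OF card_Un_le]) (simp add: card_image_le assms)
  also have "\<dots> < DIM(complex ^ 'n)" using assms by simp
  finally obtain x where x: "x \<noteq> 0" "\<And>y. y \<in> span T \<Longrightarrow> orthogonal x y"
    using orthogonal_to_subspace_exists by blast
  have "cinner v x = 0" if "v \<in> S" for v
    using x(2)[of v] x(2)[of "\<i> *s v"] that
    by (auto simp: cinner_eq_inner T_def span_base orthogonal_def inner_commute complex_eq_iff)
  with x(1) that show ?thesis by blast
qed

lemma continuous_on_cinner [continuous_intros]:
  "continuous_on S f \<Longrightarrow> continuous_on S (\<lambda>x. cinner v (f x))"
  unfolding cinner_def by (intro continuous_intros)

text \<open>The orthogonal complement \<open>W\<close> of the given eigenvectors is invariant under
  the hermitian \<open>A\<close>. A minimiser of the Rayleigh quotient on the unit sphere of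
  \<open>W\<close> is the new eigenvector, and the minimum is its eigenvalue.\<close>

lemma exists_eigenvector_orthogonal:
  fixes A :: "'n::finite cmatrix"
  assumes herm: "hermitian A" and "finite S" "card S < CARD('n)"
    and eig: "\<And>v. v \<in> S \<Longrightarrow> \<exists>c::real. A *v v = c *\<^sub>R v"
  obtains x c where "norm x = 1" "\<And>v. v \<in> S \<Longrightarrow> cinner v x = 0" "A *v x = (c::real) *\<^sub>R x"
proof -
  define W where "W = {x. \<forall>v\<in>S. cinner v x = 0}"
  have W_add: "x + y \<in> W" if "x \<in> W" "y \<in> W" for x y using that by (simp add: W_def cinner_simps)
  have W_scale: "(r::real) *\<^sub>R x \<in> W" if "x \<in> W" for x r using that by (simp add: W_def cinner_simps)
  have W_A: "A *v x \<in> W" if "x \<in> W" for x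
  proof -
    have "cinner v (A *v x) = 0" if "v \<in> S" for v
    proof -
      obtain c :: real where "A *v v = c *\<^sub>R v" using eig \<open>v \<in> S\<close> by blast
      then have "cinner v (A *v x) = cnj (cinner x (c *\<^sub>R v))"
        using herm by (metis cinner_matrix_mult cinner_cnj hermitian_def)
      also have "\<dots> = 0"
        using \<open>x \<in> W\<close> \<open>v \<in> S\<close> by (simp add: cinner_simps cinner_cnj[of x v] W_def)
      finally show ?thesis .
    qed
    then show ?thesis by (simp add: W_def)
  qed
  have "closed W"
  proof -
    have "closed {x. cinner v x = 0}" for v :: "complex ^ 'n"
      by (intro closed_Collect_eq continuous_intros)
    moreover have "W = (\<Inter>v\<in>S. {x. cinner v x = 0})" by (auto simp: W_def)
    ultimately show ?thesis by auto
  qed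
  then have comp: "compact (W \<inter> sphere 0 1)"
    by (simp add: closed_Int_compact)
  obtain x0 where "x0 \<noteq> 0" "x0 \<in> W"
  proof (rule exists_cinner_orthogonal[OF assms(2,3)])
    fix x assume "x \<noteq> 0" "\<And>v. v \<in> S \<Longrightarrow> cinner v x = 0"
    with that show thesis unfolding W_def by blast
  qed
  then have "(1 / norm x0) *\<^sub>R x0 \<in> W \<inter> sphere 0 1" by (simp add: W_scale)
  then have ne: "W \<inter> sphere 0 1 \<noteq> {}" by blast
  have "continuous_on (W \<inter> sphere 0 1) (\<lambda>x. x \<bullet> (A *v x))"
    by (intro continuous_on_inner continuous_on_id linear_continuous_on
        linear_conv_bounded_linear[THEN iffD1] matrix_vector_mul_linear)
  from continuous_attains_inf[OF comp ne this]
  obtain x where "x \<in> W \<inter> sphere 0 1"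
    and "\<forall>y\<in>W \<inter> sphere 0 1. x \<bullet> (A *v x) \<le> y \<bullet> (A *v y)" ..
  then have x: "x \<in> W" "norm x = 1"
    and min: "\<And>y. y \<in> W \<Longrightarrow> norm y = 1 \<Longrightarrow> x \<bullet> (A *v x) \<le> y \<bullet> (A *v y)"
    by simp_all
  define c where "c = x \<bullet> (A *v x)"
  \<comment> \<open>The form of \<open>B\<close> is nonnegative on \<open>W\<close> by minimality of
    \<open>c\<close> and vanishes at the minimiser \<open>x\<close>, so
    \<open>quadratic_form_zero_imp\<close> gives \<open>B *v x = 0\<close>.\<close>
  define B where "B = A - c *\<^sub>R mat 1"
  have B: "B *v y = A *v y - c *\<^sub>R y" for y
    by (simp add: B_def matrix_vector_mult_diff_rdistrib cmatrix_vector_mult_scaleR)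
  have Bnonneg: "0 \<le> y \<bullet> (B *v y)" if "y \<in> W" for y
  proof (cases "y = 0")
    case False
    define z where "z = (1 / norm y) *\<^sub>R y"
    have "c \<le> z \<bullet> (A *v z)"
      unfolding c_def using False that by (intro min) (auto simp: z_def W_scale)
    also have "z \<bullet> (A *v z) = (y \<bullet> (A *v y)) / (norm y)\<^sup>2"
      by (simp add: z_def cmatrix_vector_mult_scaleR power2_eq_square)
    finally have "c * (norm y)\<^sup>2 \<le> y \<bullet> (A *v y)" using False by (simp add: field_simps)
    then show ?thesis by (simp add: B inner_diff_right power2_norm_eq_inner)
  qed simp
  have "B *v x = 0"
  proof (rule quadratic_form_zero_imp)
    show "hermitian B"
      using herm by (simp add: hermitian_def B_def dagger_diff dagger_scaleR)
    show "x \<bullet> (B *v x) = 0"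
      using x by (simp add: B inner_diff_right c_def[symmetric] power2_norm_eq_inner[symmetric])
    show "0 \<le> (x + t *\<^sub>R (B *v x)) \<bullet> (B *v (x + t *\<^sub>R (B *v x)))" for t
    proof (rule Bnonneg)
      have "B *v x = A *v x + (- c) *\<^sub>R x" by (simp add: B)
      then have "B *v x \<in> W" using x(1) by (metis W_A W_add W_scale)
      then show "x + t *\<^sub>R (B *v x) \<in> W" using x(1) W_add W_scale by blast
    qed
  qed
  then have "A *v x = c *\<^sub>R x" by (simp add: B)
  with x that show ?thesis by (auto simp: W_def)
qed

lemma exists_orthonormal_eigenvectors:
  fixes A :: "'n::finite cmatrix"
  assumes "hermitian A" "k \<le> CARD('n)"
  shows "\<exists>S. finite S \<and> card S = k \<and> (\<forall>v\<in>S. norm v = 1 \<and> (\<exists>c::real. A *v v = c *\<^sub>R v))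
    \<and> (\<forall>v\<in>S. \<forall>w\<in>S. v \<noteq> w \<longrightarrow> cinner v w = 0)"
  using assms(2)
proof (induction k)
  case 0
  show ?case by (intro exI[of _ "{}"]) auto
next
  case (Suc k)
  then obtain S where S: "finite S" "card S = k"
      "\<forall>v\<in>S. norm v = 1 \<and> (\<exists>c::real. A *v v = c *\<^sub>R v)"
      "\<forall>v\<in>S. \<forall>w\<in>S. v \<noteq> w \<longrightarrow> cinner v w = 0" by auto
  obtain x c where x: "norm x = 1" "\<And>v. v \<in> S \<Longrightarrow> cinner v x = 0" "A *v x = (c::real) *\<^sub>R x"
    using exists_eigenvector_orthogonal[OF assms(1) S(1)] S(2,3) Suc.prems
    by (metis Suc_le_eq)
  have "x \<notin> S"
    using x(1,2) cinner_self[of x] by auto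
  moreover have "cinner x v = 0" if "v \<in> S" for v
    using x(2)[OF that] by (subst cinner_cnj) simp
  ultimately show ?case
    using S x by (intro exI[of _ "insert x S"]) auto
qed

theorem hermitian_spectral:
  fixes A :: "'n::finite cmatrix"
  assumes "hermitian A"
  obtains U d where "unitary U" "A = U ** diag_matrix (\<lambda>i. complex_of_real (d i)) ** dagger U"
proof -
  obtain S where S: "finite S" "card S = CARD('n)"
      "\<And>v. v\<in>S \<Longrightarrow> norm v = 1" "\<And>v. v \<in> S \<Longrightarrow> \<exists>c::real. A *v v = c *\<^sub>R v"
      "\<And>v w. v\<in>S \<Longrightarrow> w\<in>S \<Longrightarrow> v \<noteq> w \<Longrightarrow> cinner v w = 0"
    using exists_orthonormal_eigenvectors[OF assms order_refl] by metis
  \<comment> \<open>The columns of a matrix are indexed by the type \<open>'n\<close> itself, so the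
    eigenvectors are enumerated by a bijection from it.\<close>
  obtain e :: "'n \<Rightarrow> complex ^ 'n" where e: "bij_betw e UNIV S"
    using S(1,2) by (metis finite finite_same_card_bij)
  then have eS: "e i \<in> S" for i by (auto simp: bij_betw_def)
  obtain d :: "'n \<Rightarrow> real" where d: "\<And>i. A *v e i = d i *\<^sub>R e i"
    using S(4)[OF eS] by metis
  define U :: "'n cmatrix" where "U = (\<chi> i j. e j $ i)"
  have "(dagger U ** U) $ i $ j = (mat 1 :: 'n cmatrix) $ i $ j" for i j
  proof -
    have "(dagger U ** U) $ i $ j = cinner (e i) (e j)"
      by (simp add: U_def matrix_matrix_mult_def cinner_def)
    also have "\<dots> = (if i = j then 1 else 0)"
      using S(3)[OF eS, of i] S(5)[OF eS eS, of i j] e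
      by (auto simp: cinner_self bij_betw_def inj_on_def)
    finally show ?thesis by (simp add: mat_def)
  qed
  then have "dagger U ** U = mat 1" by (simp add: vec_eq_iff)
  then have U: "unitary U" by (simp add: unitary_def matrix_left_right_inverse)
  have "(A ** U) $ i $ j = (U ** diag_matrix (\<lambda>i. complex_of_real (d i))) $ i $ j" for i j
  proof -
    have "(A ** U) $ i $ j = (A *v e j) $ i"
      by (simp add: U_def matrix_matrix_mult_def matrix_vector_mult_def)
    then show ?thesis by (simp add: d U_def) (simp add: scaleR_conv_of_real)
  qed
  then have "A ** U = U ** diag_matrix (\<lambda>i. complex_of_real (d i))" by (simp add: vec_eq_iff)
  then have "A = U ** diag_matrix (\<lambda>i. complex_of_real (d i)) ** dagger U"
    using unitary_cancel(2)[OF U] by metis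
  with U that show ?thesis by blast
qed

section \<open>The positive square root\<close>

lemma psd_spectral:
  fixes A :: "'n::finite cmatrix"
  assumes "psd A"
  obtains U d where "unitary U" "\<forall>i. 0 \<le> d i"
    "A = U ** diag_matrix (\<lambda>i. complex_of_real (d i)) ** dagger U"
proof -
  obtain U d where U: "unitary U"
    and A: "A = U ** diag_matrix (\<lambda>i. complex_of_real (d i)) ** dagger U"
    using hermitian_spectral[OF psdD(1)[OF assms]] .
  have "dagger U ** A ** U = diag_matrix (\<lambda>i. complex_of_real (d i))"
    by (simp add: A matrix_mul_assoc unitary_cancel[OF U] unitaryD[OF U])
  moreover have "psd (dagger U ** A ** U)"
    using psd_congruence[OF assms, of "dagger U"] by simp
  ultimately have "0 \<le> Re (diag_matrix (\<lambda>i. complex_of_real (d i)) $ i $ i)" for i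
    using psd_diag by metis
  then have "0 \<le> d i" for i by (simp add: diag_matrix_def)
  with U A that show ?thesis by blast
qed

lemma exists_psd_sqrt:
  assumes "psd A"
  shows "\<exists>S. psd S \<and> S ** S = A"
proof -
  obtain U d where U: "unitary U" and d: "\<forall>i. 0 \<le> d i"
    and A: "A = U ** diag_matrix (\<lambda>i. complex_of_real (d i)) ** dagger U"
    by (rule psd_spectral[OF assms])
  define R where "R = diag_matrix (\<lambda>i. complex_of_real (sqrt (d i)))"
  have R: "R ** R = diag_matrix (\<lambda>i. complex_of_real (d i))"
    using d by (simp add: R_def diag_matrix_mult flip: of_real_mult)
  have "U ** R ** dagger U ** (U ** R ** dagger U) = U ** (R ** R) ** dagger U"
    by (simp add: matrix_mul_assoc unitary_cancel[OF U])
  moreover have "psd (U ** R ** dagger U)"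
    unfolding R_def using d by (intro psd_congruence psd_diag_matrix) simp
  ultimately show ?thesis unfolding R A by blast
qed

text \<open>For \<open>X = S - T\<close> one has \<open>S X = - X T\<close>, so the nonnegative numbers \<open>tr (X S X)\<close> and
  \<open>tr (X T X)\<close> are opposite and both vanish.\<close>

lemma psd_sqrt_unique:
  fixes S T :: "'n::finite cmatrix"
  assumes S: "psd S" and T: "psd T" and eq: "S ** S = T ** T"
  shows "S = T"
proof -
  define X where "X = S - T"
  have X: "dagger X = X"
    using psdD(1)[OF S] psdD(1)[OF T] by (simp add: X_def dagger_diff hermitian_def)
  have SX: "S ** X = - (X ** T)"
    by (simp add: X_def matrix_mult.diff_left matrix_mult.diff_right eq)
  have "trace (dagger X ** S ** X) = - trace (X ** X ** T)"
    by (simp add: X SX matrix_mul_assoc[symmetric] matrix_mult.minus_right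
        linear_neg[OF bounded_linear.linear[OF bounded_linear_trace]])
  also have "trace (X ** X ** T) = trace (dagger X ** T ** X)"
    by (metis X matrix_mul_assoc trace_mul_sym)
  finally have opp: "Re (trace (dagger X ** S ** X)) = - Re (trace (dagger X ** T ** X))" by simp
  have "0 \<le> Re (trace (dagger X ** S ** X))" "0 \<le> Re (trace (dagger X ** T ** X))"
    using psd_congruence[OF S, of "dagger X"] psd_congruence[OF T, of "dagger X"]
    by (simp_all add: psd_trace_nonneg)
  with opp have "S ** X = 0" "T ** X = 0"
    by (auto intro!: psd_trace_conjugation_zero S T)
  then have "X ** X = 0"
    by (simp add: X_def matrix_mult.diff_left)
  then have "(norm X)\<^sup>2 = 0"
    by (simp add: norm_matrix_square X trace_def)
  then show ?thesis by (simp add: X_def)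
qed

lemma msqrt_eqI: "psd S \<Longrightarrow> S ** S = A \<Longrightarrow> msqrt A = S"
  unfolding msqrt_def by (rule the_equality) (auto intro: psd_sqrt_unique)

lemma msqrt:
  assumes "psd A"
  shows "psd (msqrt A)" "msqrt A ** msqrt A = A" "dagger (msqrt A) = msqrt A"
proof -
  obtain S where "psd S" "S ** S = A" using exists_psd_sqrt[OF assms] by blast
  moreover from this have "msqrt A = S" by (rule msqrt_eqI)
  ultimately show "psd (msqrt A)" "msqrt A ** msqrt A = A" by auto
  then show "dagger (msqrt A) = msqrt A" using psdD(1) hermitian_def by blast
qed

lemma msqrt_unitary_conj:
  assumes "psd A" and U: "unitary U"
  shows "msqrt (U ** A ** dagger U) = U ** msqrt A ** dagger U"
proof (rule msqrt_eqI)
  show "psd (U ** msqrt A ** dagger U)" using assms by (intro psd_congruence msqrt)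
  have "U ** msqrt A ** dagger U ** (U ** msqrt A ** dagger U)
      = U ** (msqrt A ** msqrt A) ** dagger U"
    by (simp add: matrix_mul_assoc unitary_cancel[OF U])
  then show "U ** msqrt A ** dagger U ** (U ** msqrt A ** dagger U) = U ** A ** dagger U"
    by (simp add: msqrt assms)
qed

lemma norm_msqrt: "psd A \<Longrightarrow> (norm (msqrt A))\<^sup>2 = Re (trace A)"
  by (simp add: norm_matrix_square msqrt)

section \<open>Closedness of the positive cone and continuity of the square root\<close>

lemma closed_psd: "closed {S :: 'n::finite cmatrix. psd S}"
proof -
  have "closed {S :: 'n cmatrix. 0 \<le> x \<bullet> (S *v x)}" for x
    by (intro closed_Collect_le continuous_intros linear_continuous_on bounded_linear_quadratic_form)
  moreover have "closed {S :: 'n cmatrix. dagger S = S}"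
    by (intro closed_Collect_eq continuous_intros linear_continuous_on bounded_linear_dagger)
  moreover have "{S :: 'n cmatrix. psd S} =
      {S. dagger S = S} \<inter> (\<Inter>x. {S. 0 \<le> x \<bullet> (S *v x)})"
    by (auto simp: psd_iff hermitian_def)
  ultimately show ?thesis by auto
qed

lemma continuous_on_matrix_mult [continuous_intros]:
  fixes f g :: "'a::topological_space \<Rightarrow> 'n::finite cmatrix"
  shows "continuous_on S f \<Longrightarrow> continuous_on S g \<Longrightarrow> continuous_on S (\<lambda>x. f x ** g x)"
  by (rule matrix_mult.continuous_on)

lemma continuous_on_dagger [continuous_intros]:
  fixes f :: "'a::topological_space \<Rightarrow> 'n::finite cmatrix"
  shows "continuous_on S f \<Longrightarrow> continuous_on S (\<lambda>x. dagger (f x))"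
  by (rule bounded_linear.continuous_on[OF bounded_linear_dagger])

lemma continuous_on_trace [continuous_intros]:
  fixes f :: "'a::topological_space \<Rightarrow> 'n::finite cmatrix"
  shows "continuous_on S f \<Longrightarrow> continuous_on S (\<lambda>x. trace (f x))"
  by (rule bounded_linear.continuous_on[OF bounded_linear_trace])

text \<open>Squaring is a continuous injection on the compact set of positive matrices of norm at most
  \<open>R\<close>, so its inverse is continuous.\<close>

lemma continuous_on_msqrt:
  "continuous_on {A :: 'n::finite cmatrix. psd A \<and> Re (trace A) \<le> R} msqrt"
proof (cases "R \<ge> 0")
  case True
  define C where "C = {S :: 'n cmatrix. psd S} \<inter> cball 0 (sqrt R)"
  have "compact C"
    unfolding C_def by (intro closed_Int_compact closed_psd compact_cball)
  then have "continuous_on ((\<lambda>S. S ** S) ` C) msqrt"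
    by (intro continuous_on_inv continuous_intros) (auto simp: C_def intro: msqrt_eqI)
  moreover have "{A :: 'n cmatrix. psd A \<and> Re (trace A) \<le> R} \<subseteq> (\<lambda>S. S ** S) ` C"
  proof
    fix A :: "'n cmatrix" assume "A \<in> {A. psd A \<and> Re (trace A) \<le> R}"
    then have A: "psd A" "(norm (msqrt A))\<^sup>2 \<le> R" by (auto simp: norm_msqrt)
    then have "msqrt A \<in> C" by (simp add: C_def msqrt real_le_rsqrt)
    moreover have "A = msqrt A ** msqrt A" using A by (simp add: msqrt)
    ultimately show "A \<in> (\<lambda>S. S ** S) ` C" by blast
  qed
  ultimately show ?thesis using continuous_on_subset by blast
next
  case False
  then have "{A :: 'n cmatrix. psd A \<and> Re (trace A) \<le> R} = {}"
    by (auto dest!: psd_trace_nonneg)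
  then show ?thesis by (simp only: continuous_on_empty)
qed

section \<open>Fidelity and the Bures angle\<close>

text \<open>In the eigenbasis of \<open>S\<close>, where \<open>B\<close> becomes \<open>C\<close>,
  the hypothesis bounds the \<open>i\<close>-th diagonal entry of \<open>C ** dagger C\<close> by
  the squared eigenvalue. That entry dominates the squared modulus of the diagonal entry of
  \<open>C\<close>, and summing over the diagonal compares the traces.\<close>

lemma trace_le_trace_of_sqrt:
  fixes B S :: "'n::finite cmatrix"
  assumes "psd S" "psd (S ** S - B ** dagger B)"
  shows "Re (trace B) \<le> Re (trace S)"
proof -
  obtain U d where U: "unitary U" and d: "\<forall>i. 0 \<le> d i"
    and S: "S = U ** diag_matrix (\<lambda>i. complex_of_real (d i)) ** dagger U"
    by (rule psd_spectral[OF assms(1)])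
  define D where "D = diag_matrix (\<lambda>i. complex_of_real (d i))"
  define C where "C = dagger U ** B ** U"
  have "dagger U ** (S ** S - B ** dagger B) ** U = D ** D - C ** dagger C"
    by (simp add: S D_def C_def matrix_mult.diff_left matrix_mult.diff_right dagger_mult
        matrix_mul_assoc unitary_cancel[OF U] unitaryD[OF U])
  moreover have "psd (dagger U ** (S ** S - B ** dagger B) ** U)"
    using psd_congruence[OF assms(2), of "dagger U"] by simp
  ultimately have nonneg: "0 \<le> Re ((D ** D - C ** dagger C) $ i $ i)" for i
    by (metis psd_diag)
  have diag: "Re (C $ i $ i) \<le> d i" for i
  proof -
    have CC: "Re ((C ** dagger C) $ i $ i) = (\<Sum>j\<in>UNIV. (cmod (C $ i $ j))\<^sup>2)"
      by (simp add: matrix_matrix_mult_def complex_mult_cnj cmod_power2)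
    have "(cmod (C $ i $ i))\<^sup>2 \<le> Re ((C ** dagger C) $ i $ i)"
      unfolding CC by (rule member_le_sum) auto
    also have "\<dots> \<le> (d i)\<^sup>2"
    proof -
      have "Re ((D ** D) $ i $ i) = (d i)\<^sup>2"
        unfolding D_def diag_matrix_mult by (simp add: diag_matrix_def power2_eq_square)
      then show ?thesis using nonneg[of i] by simp
    qed
    finally have "cmod (C $ i $ i) \<le> d i" by (rule power2_le_imp_le) (simp add: d)
    then show ?thesis by (rule order_trans[OF complex_Re_le_cmod])
  qed
  have "Re (trace B) = Re (trace C)"
    using trace_conj_unitary[OF unitary_dagger[OF U], of B] by (simp add: C_def)
  also have "\<dots> \<le> (\<Sum>i\<in>UNIV. d i)"
    by (simp add: trace_def sum_mono diag)
  also have "\<dots> = Re (trace S)"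
    by (simp add: S trace_conj_unitary[OF U]) (simp add: trace_def diag_matrix_def)
  finally show ?thesis .
qed

text \<open>With \<open>S = U D U\<^sup>\<dagger>\<close> and \<open>C = U\<^sup>\<dagger> X Y\<close>, the partial isometry \<open>F\<close> of the polar decomposition
  satisfies \<open>D = F C\<^sup>\<dagger>\<close>, and the Cauchy-Schwarz inequality applies to the trace of the adjoint
  \<open>(U\<^sup>\<dagger> X) (Y F\<^sup>\<dagger>)\<close> of \<open>D\<close>. The junk value \<open>1 / 0 = 0\<close> makes \<open>E\<close> the pseudoinverse of \<open>D\<close>.\<close>

lemma trace_sqrt_le_norm_mult_norm:
  fixes S X Y :: "'n::finite cmatrix"
  assumes "psd S" and SS: "S ** S = (X ** Y) ** dagger (X ** Y)"
  shows "Re (trace S) \<le> norm X * norm Y"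
proof -
  obtain U d where U: "unitary U" and d: "\<forall>i. 0 \<le> d i"
    and S: "S = U ** diag_matrix (\<lambda>i. complex_of_real (d i)) ** dagger U"
    by (rule psd_spectral[OF assms(1)])
  define D where "D = diag_matrix (\<lambda>i. complex_of_real (d i))"
  define E where "E = diag_matrix (\<lambda>i. complex_of_real (1 / d i))"
  define C where "C = dagger U ** (X ** Y)"
  define F where "F = E ** C"
  have "C ** dagger C = dagger U ** (S ** S) ** U"
    by (simp add: SS C_def dagger_mult matrix_mul_assoc)
  also have "\<dots> = D ** D"
    by (simp add: S D_def matrix_mul_assoc unitary_cancel[OF U] unitaryD[OF U])
  finally have CC: "C ** dagger C = D ** D" .
  have dagE: "dagger E = E" by (simp add: E_def dagger_diag_matrix)
  have ed: "complex_of_real (1 / x) * (complex_of_real x * complex_of_real x) = complex_of_real x"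
      "complex_of_real x * complex_of_real (1 / x) * complex_of_real (1 / x) = complex_of_real (1 / x)"
    for x :: real
    by (cases "x = 0"; simp)+
  have EDD: "E ** (D ** D) = D"
    unfolding E_def D_def diag_matrix_mult ed ..
  have EDE: "E ** (D ** D) ** E ** E = E"
    unfolding E_def D_def diag_matrix_mult ed ..
  have D: "F ** dagger C = D" by (simp add: F_def matrix_mul_assoc[symmetric] CC EDD)
  have FFF: "F ** dagger F ** F = F"
  proof -
    have "F ** dagger F ** F = E ** (C ** dagger C) ** E ** E ** C"
      by (simp add: F_def dagger_mult dagE matrix_mul_assoc)
    then show ?thesis by (simp add: CC EDE F_def)
  qed
  \<comment> \<open>As \<open>F\<close> is a partial isometry, \<open>dagger F ** F\<close> and
    \<open>Q\<close> are complementary orthogonal projections. The squared norm of \<open>Y\<close>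
    splits into those of \<open>Y ** Q\<close> and \<open>Y ** dagger F\<close>, so multiplication
    by \<open>dagger F\<close> does not lengthen \<open>Y\<close>.\<close>
  define Q where "Q = mat 1 - dagger F ** F"
  have dagQ: "dagger Q = Q" by (simp add: Q_def dagger_diff dagger_mult)
  have QQ: "Q ** Q = Q"
    using FFF by (simp add: Q_def matrix_mult.diff_left matrix_mult.diff_right matrix_mul_assoc)
      (simp add: matrix_mul_assoc[symmetric])
  have "(norm (Y ** Q))\<^sup>2 = Re (trace (Q ** (dagger Y ** Y ** Q)))"
    by (simp add: norm_matrix_square dagger_mult dagQ matrix_mul_assoc)
  also have "\<dots> = Re (trace (dagger Y ** Y ** (Q ** Q)))"
    by (subst trace_mul_sym) (simp add: matrix_mul_assoc)
  also have "\<dots> = (norm Y)\<^sup>2 - Re (trace (dagger Y ** Y ** dagger F ** F))"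
    unfolding QQ by (simp add: Q_def matrix_mult.diff_right norm_matrix_square matrix_mul_assoc trace_sub)
  also have "trace (dagger Y ** Y ** dagger F ** F) = trace (F ** (dagger Y ** Y ** dagger F))"
    by (rule trace_mul_sym)
  also have "Re \<dots> = (norm (Y ** dagger F))\<^sup>2"
    by (simp add: norm_matrix_square dagger_mult matrix_mul_assoc)
  finally have "(norm (Y ** dagger F))\<^sup>2 \<le> (norm Y)\<^sup>2"
    using zero_le_power2[of "norm (Y ** Q)"] by linarith
  then have YF: "norm (Y ** dagger F) \<le> norm Y"
    by (rule power2_le_imp_le) simp
  have "(norm (dagger X ** U))\<^sup>2 = Re (trace (dagger U ** (X ** dagger X) ** U))"
    by (simp add: norm_matrix_square dagger_mult matrix_mul_assoc)
  also have "\<dots> = Re (trace (X ** dagger X))"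
    using trace_conj_unitary[OF unitary_dagger[OF U], of "X ** dagger X"] by simp
  also have "\<dots> = (norm X)\<^sup>2"
    by (subst trace_mul_sym) (simp add: norm_matrix_square)
  finally have XU: "norm (dagger X ** U) = norm X"
    by (simp add: power2_eq_iff_nonneg)
  have "Re (trace S) = Re (trace D)"
    by (simp add: S D_def trace_conj_unitary[OF U])
  also have "\<dots> = Re (trace (dagger D))" by (simp add: trace_dagger)
  also have "dagger D = C ** dagger F" by (simp add: D[symmetric] dagger_mult)
  also have "\<dots> = dagger (dagger X ** U) ** (Y ** dagger F)"
    by (simp add: C_def dagger_mult matrix_mul_assoc)
  also have "Re (trace \<dots>) = (dagger X ** U) \<bullet> (Y ** dagger F)"
    by (simp add: inner_eq_trace)
  also have "\<dots> \<le> norm (dagger X ** U) * norm (Y ** dagger F)"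
    by (rule norm_cauchy_schwarz)
  also have "\<dots> \<le> norm X * norm Y"
    unfolding XU by (intro mult_left_mono YF) simp
  finally show ?thesis .
qed

lemma density_opD:
  assumes "density_op \<rho>"
  shows "psd \<rho>" "trace \<rho> = 1" "norm (msqrt \<rho>) = 1"
proof -
  show *: "psd \<rho>" "trace \<rho> = 1" using assms by (auto simp: density_op_def)
  have "(norm (msqrt \<rho>))\<^sup>2 = 1" using * by (simp add: norm_msqrt)
  then show "norm (msqrt \<rho>) = 1" 
    by (metis norm_ge_zero one_power2 power2_eq_imp_eq zero_le_one)
qed

lemma density_op_unitary_conj:
  "density_op \<rho> \<Longrightarrow> unitary U \<Longrightarrow> density_op (U ** \<rho> ** dagger U)"
  by (simp add: density_op_def psd_congruence trace_conj_unitary)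

lemma psd_sqrt_conj: "psd \<rho> \<Longrightarrow> psd \<sigma> \<Longrightarrow> psd (msqrt \<rho> ** \<sigma> ** msqrt \<rho>)"
  using psd_congruence[of \<sigma> "msqrt \<rho>"] by (simp add: msqrt)

lemma sqrt_fidelity:
  assumes "psd \<rho>" "psd \<sigma>"
  shows "sqrt (fidelity \<rho> \<sigma>) = Re (trace (msqrt (msqrt \<rho> ** \<sigma> ** msqrt \<rho>)))"
  unfolding fidelity_def using assms
  by (simp add: psd_trace_nonneg msqrt psd_sqrt_conj)

text \<open>Splitting \<sigma> as the square of its root \<open>s\<close>, with \<open>r\<close> the
  root of \<rho>, the operator under the outer root is \<open>(r ** s) ** dagger (r ** s)\<close>,
  so its trace norm is at most the product of two Frobenius norms equal to 1. The bound keeps the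
  argument of \<open>arccos\<close> inside its domain.\<close>

lemma sqrt_fidelity_le_1:
  assumes "density_op \<rho>" "density_op \<sigma>"
  shows "sqrt (fidelity \<rho> \<sigma>) \<le> 1"
proof -
  note \<rho> = density_opD[OF assms(1)] and \<sigma> = density_opD[OF assms(2)]
  let ?r = "msqrt \<rho>" and ?s = "msqrt \<sigma>"
  have "?r ** \<sigma> ** ?r = ?r ** (?s ** ?s) ** ?r" using \<sigma> by (simp add: msqrt)
  also have "\<dots> = (?r ** ?s) ** dagger (?r ** ?s)"
    using \<rho> \<sigma> by (simp add: dagger_mult msqrt(3) matrix_mul_assoc)
  finally have "Re (trace (msqrt (?r ** \<sigma> ** ?r))) \<le> norm ?r * norm ?s"
    using \<rho> \<sigma> psd_sqrt_conj[of \<rho> \<sigma>] by (intro trace_sqrt_le_norm_mult_norm) (metis msqrt)+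
  then show ?thesis using \<rho> \<sigma> by (simp add: sqrt_fidelity)
qed

text \<open>This turns domination of states into a fidelity bound. Sandwiching the hypothesis
  between the roots \<open>r\<close> of \<rho> shows that \<open>B = r ** M ** r\<close> satisfies
  the premise of \<open>trace_le_trace_of_sqrt\<close>, and cyclicity makes its trace that of
  \<open>M ** \<rho>\<close>.\<close>

lemma trace_le_sqrt_fidelity:
  assumes "psd \<rho>" "psd \<sigma>" and le: "psd (\<sigma> - M ** \<rho> ** dagger M)"
  shows "Re (trace (M ** \<rho>)) \<le> sqrt (fidelity \<rho> \<sigma>)"
proof -
  let ?r = "msqrt \<rho>"
  define P where "P = ?r ** \<sigma> ** ?r"
  define B where "B = ?r ** M ** ?r"
  note r = msqrt[OF assms(1)]
  have "psd P" using assms psd_sqrt_conj by (simp add: P_def)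
  have "B ** dagger B = ?r ** M ** (?r ** ?r) ** dagger M ** ?r"
    by (simp add: B_def dagger_mult r(3) matrix_mul_assoc)
  then have "P - B ** dagger B = ?r ** (\<sigma> - M ** \<rho> ** dagger M) ** dagger ?r"
    by (simp add: P_def r matrix_mult.diff_left matrix_mult.diff_right matrix_mul_assoc)
  then have "psd (msqrt P ** msqrt P - B ** dagger B)"
    using psd_congruence[OF le, of ?r] by (simp add: msqrt \<open>psd P\<close>)
  then have "Re (trace B) \<le> Re (trace (msqrt P))"
    by (intro trace_le_trace_of_sqrt msqrt \<open>psd P\<close>)
  moreover have "trace B = trace (M ** \<rho>)"
    by (metis B_def matrix_mul_assoc r(2) trace_mul_sym)
  ultimately show ?thesis using assms by (simp add: sqrt_fidelity P_def)
qed

text \<open>Root and trace are both compatible with unitary conjugation. Moving \<open>V\<close> to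
  the second argument identifies a point of the unitary orbit with the interaction picture.\<close>

lemma bures_angle_unitary_conj:
  assumes "psd \<rho>" "psd \<sigma>" and V: "unitary V"
  shows "bures_angle (V ** \<rho> ** dagger V) \<sigma> = bures_angle \<rho> (dagger V ** \<sigma> ** V)"
proof -
  let ?P = "msqrt \<rho> ** (dagger V ** \<sigma> ** V) ** msqrt \<rho>"
  have "psd ?P"
    using psd_congruence[OF assms(2), of "dagger V"] assms(1) by (intro psd_sqrt_conj) simp_all
  have "msqrt (V ** \<rho> ** dagger V) ** \<sigma> ** msqrt (V ** \<rho> ** dagger V) = V ** ?P ** dagger V"
    by (simp add: msqrt_unitary_conj[OF assms(1) V] matrix_mul_assoc)
  then show ?thesis
    by (simp add: bures_angle_def fidelity_def msqrt_unitary_conj[OF \<open>psd ?P\<close> V]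
        trace_conj_unitary[OF V])
qed

section \<open>Compactness of the unitary group and the minimum over an orbit\<close>

lemma compact_unitary: "compact {U :: 'n::finite cmatrix. unitary U}"
proof (rule compact_eq_bounded_closed[THEN iffD2], rule conjI)
  have "norm U = norm (mat 1 :: 'n cmatrix)" if "unitary U" for U :: "'n cmatrix"
  proof -
    have "(norm U)\<^sup>2 = (norm (mat 1 :: 'n cmatrix))\<^sup>2"
      by (simp add: norm_matrix_square unitaryD[OF that])
    then show ?thesis by (simp add: power2_eq_iff_nonneg)
  qed
  then show "bounded {U :: 'n cmatrix. unitary U}"
    unfolding bounded_iff by (metis mem_Collect_eq order_refl)
  have "closed {U :: 'n cmatrix. dagger U ** U = mat 1}" "closed {U :: 'n cmatrix. U ** dagger U = mat 1}"
    by (intro closed_Collect_eq continuous_intros)+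
  moreover have "{U :: 'n cmatrix. unitary U}
      = {U. dagger U ** U = mat 1} \<inter> {U. U ** dagger U = mat 1}"
    by (auto simp: unitary_def)
  ultimately show "closed {U :: 'n cmatrix. unitary U}" by auto
qed

lemma continuous_on_bures_angle_orbit:
  assumes \<rho>: "density_op \<rho>" and \<sigma>: "density_op \<sigma>"
  shows "continuous_on {U. unitary U} (\<lambda>U. bures_angle (U ** \<rho> ** dagger U) \<sigma>)"
proof -
  \<comment> \<open>Here the root of \<rho> is taken before conjugation, so \<open>P\<close> is
    built from \<open>U\<close> and \<open>dagger U\<close> by products alone and its continuity is
    immediate.\<close>
  define P where "P U = (U ** msqrt \<rho> ** dagger U) ** \<sigma> ** (U ** msqrt \<rho> ** dagger U)" for U
  have P: "P U = msqrt (U ** \<rho> ** dagger U) ** \<sigma> ** msqrt (U ** \<rho> ** dagger U)" if "unitary U" for U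
    by (simp add: P_def msqrt_unitary_conj[OF density_opD(1)[OF \<rho>] that])
  have psdP: "psd (P U)" if "unitary U" for U
    unfolding P[OF that] using \<rho> \<sigma> that
    by (intro psd_sqrt_conj) (auto dest: density_opD simp: psd_congruence)
  have contP: "continuous_on {U. unitary U} P"
    unfolding P_def by (intro continuous_intros)
  \<comment> \<open>Continuity of \<open>msqrt\<close> is available on sets of bounded trace;
    compactness of the unitary group supplies one bound \<open>R\<close> for the whole
    orbit.\<close>
  then have "compact ((\<lambda>U. Re (trace (P U))) ` {U. unitary U})"
    by (intro compact_continuous_image continuous_intros compact_unitary)
  then obtain R where "\<And>U. unitary U \<Longrightarrow> Re (trace (P U)) \<le> R"
    by (auto dest!: compact_imp_bounded simp: bounded_iff) (metis abs_le_D1)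
  then have "P ` {U. unitary U} \<subseteq> {A. psd A \<and> Re (trace A) \<le> R}"
    using psdP by auto
  then have cont: "continuous_on {U. unitary U} (\<lambda>U. msqrt (P U))"
    using continuous_on_compose2[OF continuous_on_msqrt contP] by blast
  have fid: "sqrt (fidelity (U ** \<rho> ** dagger U) \<sigma>) = Re (trace (msqrt (P U)))"
      "0 \<le> Re (trace (msqrt (P U)))" "Re (trace (msqrt (P U))) \<le> 1"
    if "unitary U" for U
  proof -
    have \<rho>U: "density_op (U ** \<rho> ** dagger U)" using \<rho> that by (rule density_op_unitary_conj)
    then show *: "sqrt (fidelity (U ** \<rho> ** dagger U) \<sigma>) = Re (trace (msqrt (P U)))"
      using \<sigma> by (simp add: sqrt_fidelity density_opD P[OF that])
    show "Re (trace (msqrt (P U))) \<le> 1"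
      unfolding *[symmetric] by (rule sqrt_fidelity_le_1[OF \<rho>U \<sigma>])
    show "0 \<le> Re (trace (msqrt (P U)))"
      using psdP[OF that] by (simp add: psd_trace_nonneg msqrt)
  qed
  have "continuous_on {U. unitary U} (\<lambda>U. arccos (Re (trace (msqrt (P U)))))"
    using fid by (intro continuous_intros cont) force
  then show ?thesis
    by (rule continuous_on_cong[THEN iffD1, rotated -1]) (simp_all add: bures_angle_def fid)
qed

text \<open>The \<open>LEAST\<close> in the definition has a usable value only once the minimum is
  attained, which continuity on the compact unitary group provides.\<close>

lemma bures_angle_orbit_le:
  fixes \<rho> \<sigma> U :: "'n::finite cmatrix"
  assumes "density_op \<rho>" "density_op \<sigma>" "unitary U"
  shows "bures_angle_orbit \<rho> \<sigma> \<le> bures_angle (U ** \<rho> ** dagger U) \<sigma>"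
proof -
  let ?f = "\<lambda>U. bures_angle (U ** \<rho> ** dagger U) \<sigma>"
  have "{U. unitary U} \<noteq> ({} :: 'n cmatrix set)" using assms(3) by blast
  from continuous_attains_inf[OF compact_unitary this continuous_on_bures_angle_orbit[OF assms(1,2)]]
  obtain U0 where U0: "unitary U0" "\<And>U. unitary U \<Longrightarrow> ?f U0 \<le> ?f U"
    unfolding Ball_def Bex_def mem_Collect_eq by blast
  then have "bures_angle_orbit \<rho> \<sigma> = ?f U0"
    unfolding bures_angle_orbit_def by (intro Least_equality) auto
  with U0(2)[OF assms(3)] show ?thesis by simp
qed

section \<open>A scalar inequality\<close>

text \<open>The difference of the two sides is 0 at 0, and its derivative factors as
  \<open>exp (- u / 2) * (exp (- u / 2) - (1 - u / 2))\<close>, which is nonnegative because the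
  exponential lies above its tangent at 0.\<close>

lemma mult_exp_le_one_minus_exp:
  fixes x :: real
  assumes "0 \<le> x"
  shows "x * exp (- x / 2) \<le> 1 - exp (- x)"
proof -
  let ?f = "\<lambda>x::real. 1 - exp (- x) - x * exp (- x / 2)"
  have "?f 0 \<le> ?f x"
  proof (rule DERIV_nonneg_imp_nondecreasing[OF assms])
    fix u :: real assume "0 \<le> u" "u \<le> x"
    have "(?f has_real_derivative exp (- u) - exp (- u / 2) + u / 2 * exp (- u / 2)) (at u)"
      by (auto intro!: derivative_eq_intros)
    moreover have "0 \<le> exp (- u / 2) * (exp (- u / 2) - (1 + (- u / 2)))"
      using exp_ge_add_one_self[of "- u / 2"] by (intro mult_nonneg_nonneg) auto
    moreover have "exp (- u) = exp (- u / 2) * exp (- u / 2)" by (simp flip: exp_add)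
    then have "exp (- u / 2) * (exp (- u / 2) - (1 + (- u / 2)))
        = exp (- u) - exp (- u / 2) + u / 2 * exp (- u / 2)"
      by (simp add: algebra_simps)
    ultimately show "\<exists>y. (?f has_real_derivative y) (at u) \<and> 0 \<le> y" by auto
  qed
  then show ?thesis by simp
qed

text \<open>The variance of \<open>y\<close> under the probability weights \<open>p\<close> is
  nonnegative.\<close>

lemma square_mean_le_mean_square:
  fixes p y :: "'n::finite \<Rightarrow> real"
  assumes "\<And>i. 0 \<le> p i" "sum p UNIV = 1"
  shows "(\<Sum>i\<in>UNIV. p i * y i)\<^sup>2 \<le> (\<Sum>i\<in>UNIV. p i * (y i)\<^sup>2)"
proof -
  define g where "g = (\<Sum>i\<in>UNIV. p i * y i)"
  have "0 \<le> (\<Sum>i\<in>UNIV. p i * (y i - g)\<^sup>2)"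
    using assms by (intro sum_nonneg) auto
  also have "\<dots> = (\<Sum>i\<in>UNIV. p i * (y i)\<^sup>2 - 2 * g * (p i * y i) + g\<^sup>2 * p i)"
    by (simp add: power2_eq_square algebra_simps)
  also have "\<dots> = (\<Sum>i\<in>UNIV. p i * (y i)\<^sup>2) - g\<^sup>2"
    by (simp add: sum.distrib sum_subtractf sum_distrib_left[symmetric] assms(2) g_def[symmetric])
      (simp add: power2_eq_square)
  finally show ?thesis by (simp add: g_def)
qed

text \<open>Here \<open>s\<close> is minus the derivative of \<open>g\<close>, and \<theta> is the
  derivative of \<open>arccos g\<close>. The quantity \<open>1 - a t\<close> is at most
  \<open>A t\<close> and at most \<open>1 - (g t)\<^sup>2\<close>, hence at most the product of
  their square roots; dividing \<open>2 * t * s t \<le> 1 - a t\<close> by that second root bounds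
  \<theta>.\<close>

lemma arccos_exp_mean_le_integral:
  fixes p k :: "'n::finite \<Rightarrow> real"
  assumes p: "\<And>i. 0 \<le> p i" "sum p UNIV = 1" and k: "\<And>i. 0 \<le> k i" and "0 < \<tau>"
    and A: "\<And>t. 0 \<le> t \<Longrightarrow> t \<le> \<tau> \<Longrightarrow> 1 - (\<Sum>i\<in>UNIV. p i * exp (- t * k i)) \<le> A t"
    and int: "(\<lambda>t. sqrt (A t) / t) integrable_on {0..\<tau>}"
  shows "arccos (\<Sum>i\<in>UNIV. p i * exp (- \<tau> / 2 * k i)) \<le> 1/2 * integral {0..\<tau>} (\<lambda>t. sqrt (A t) / t)"
proof -
  define g where "g t = (\<Sum>i\<in>UNIV. p i * exp (- t / 2 * k i))" for t
  define s where "s t = (\<Sum>i\<in>UNIV. p i * (k i / 2 * exp (- t / 2 * k i)))" for t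
  define a where "a t = (\<Sum>i\<in>UNIV. p i * exp (- t * k i))" for t
  define \<theta> where "\<theta> t = s t / sqrt (1 - (g t)\<^sup>2)" for t
  have g_0: "g 0 = 1" by (simp add: g_def p)
  have g_nonneg: "0 \<le> g t" for t unfolding g_def by (intro sum_nonneg) (simp add: p)
  have g_le: "g t \<le> 1" if "0 \<le> t" for t
  proof -
    have "g t \<le> sum p UNIV"
      unfolding g_def using p k that by (intro sum_mono mult_left_le) (auto simp: mult_nonneg_nonneg)
    then show ?thesis by (simp add: p)
  qed
  have g2: "(g t)\<^sup>2 \<le> a t" for t
    using square_mean_le_mean_square[OF p, of "\<lambda>i. exp (- t / 2 * k i)"]
    by (simp add: g_def a_def power2_eq_square flip: exp_add)
  have a_le: "a t \<le> 1" if "0 \<le> t" for t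
  proof -
    have "a t \<le> sum p UNIV"
      unfolding a_def using p k that by (intro sum_mono mult_left_le) (auto simp: mult_nonneg_nonneg)
    then show ?thesis by (simp add: p)
  qed
  have s_le: "2 * t * s t \<le> 1 - a t" if "0 \<le> t" for t
  proof -
    have "2 * t * s t = (\<Sum>i\<in>UNIV. p i * (t * k i * exp (- (t * k i) / 2)))"
      by (simp add: s_def sum_distrib_left algebra_simps)
    also have "\<dots> \<le> (\<Sum>i\<in>UNIV. p i * (1 - exp (- (t * k i))))"
      using that p k by (intro sum_mono mult_left_mono mult_exp_le_one_minus_exp) auto
    also have "\<dots> = 1 - a t"
      by (simp add: a_def right_diff_distrib sum_subtractf p)
    finally show ?thesis .
  qed
  \<comment> \<open>At \<open>t = 0\<close> and where \<open>g\<close> equals 1, division by zero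
    gives \<theta> the value 0, so only nonnegativity of the right side remains to be checked
    there.\<close>
  have bound: "\<theta> t \<le> 1/2 * (sqrt (A t) / t)" if t: "0 \<le> t" "t \<le> \<tau>" for t
  proof (cases "t = 0 \<or> (g t)\<^sup>2 = 1")
    case True
    have "0 \<le> 1 - a t" using a_le t by simp
    also have "\<dots> \<le> A t" using A t by (simp add: a_def)
    finally show ?thesis using True t by (auto simp: \<theta>_def g_0)
  next
    case False
    define b where "b = 1 - a t"
    have "0 \<le> b" using a_le t by (simp add: b_def)
    have "b \<le> A t" using A t by (simp add: a_def b_def)
    have "b \<le> 1 - (g t)\<^sup>2" using g2[of t] by (simp add: b_def)
    have "(g t)\<^sup>2 \<le> 1" using g_le[OF t(1)] g_nonneg by (simp add: power_le_one)
    with False have pos: "0 < 1 - (g t)\<^sup>2" "0 < t" using t by auto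
    have "2 * t * s t \<le> sqrt b * sqrt b" using s_le t \<open>0 \<le> b\<close> by (simp add: b_def)
    also have "\<dots> \<le> sqrt (A t) * sqrt (1 - (g t)\<^sup>2)"
      using \<open>b \<le> A t\<close> \<open>b \<le> 1 - (g t)\<^sup>2\<close> \<open>0 \<le> b\<close> by (intro mult_mono) auto
    finally show ?thesis
      using pos by (simp add: \<theta>_def field_simps)
  qed
  \<comment> \<open>If all weight sits at \<open>k i = 0\<close>, then \<open>g\<close> is
    constantly 1 and the angle is 0. Otherwise \<open>g t < 1\<close> for positive \<open>t\<close>,
    which makes \<open>arccos\<close> differentiable at \<open>g t\<close>.\<close>
  show ?thesis
  proof (cases "\<exists>i. p i \<noteq> 0 \<and> k i \<noteq> 0")
    case False
    then have "p i * exp (- \<tau> / 2 * k i) = p i" for i by (cases "p i = 0") auto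
    then have "arccos (\<Sum>i\<in>UNIV. p i * exp (- \<tau> / 2 * k i)) = 0"
      by (simp only: p arccos_1)
    moreover have "0 \<le> sqrt (A t) / t" if "0 \<le> t" "t \<le> \<tau>" for t
      using A[OF that] a_le[OF that(1)] that by (auto simp: a_def)
    then have "0 \<le> integral {0..\<tau>} (\<lambda>t. sqrt (A t) / t)"
      by (intro integral_nonneg int) auto
    ultimately show ?thesis by simp
  next
    case True
    then obtain j where j: "0 < p j" "0 < k j"
      by (metis p(1) k less_eq_real_def)
    have g_less: "g t < 1" if "0 < t" for t
    proof -
      have "g t < sum p UNIV"
        unfolding g_def
      proof (rule sum_strict_mono_ex1)
        show "\<forall>i\<in>UNIV. p i * exp (- t / 2 * k i) \<le> p i"
          using p k that by (auto intro!: mult_left_le)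
        show "\<exists>i\<in>UNIV. p i * exp (- t / 2 * k i) < p i"
          using j that by (intro bexI[of _ j]) auto
      qed simp
      then show ?thesis by (simp add: p)
    qed
    have "((\<lambda>t. arccos (g t)) has_vector_derivative \<theta> t) (at t)" if "t \<in> {0<..<\<tau>}" for t
    proof -
      have "(g has_real_derivative - s t) (at t)"
        unfolding g_def s_def
        by (auto intro!: derivative_eq_intros simp: sum_negf[symmetric] algebra_simps)
      moreover have "(arccos has_real_derivative inverse (- sqrt (1 - (g t)\<^sup>2))) (at (g t))"
        using g_less[of t] g_nonneg[of t] that by (intro DERIV_arccos) auto
      ultimately have "((\<lambda>t. arccos (g t)) has_real_derivative
          inverse (- sqrt (1 - (g t)\<^sup>2)) * - s t) (at t)"
        by (rule DERIV_chain2[rotated])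
      then show ?thesis
        by (simp add: has_real_derivative_iff_has_vector_derivative \<theta>_def divide_inverse mult.commute)
    qed
    moreover have "continuous_on {0..\<tau>} g"
      unfolding g_def by (intro continuous_intros) auto
    then have "continuous_on {0..\<tau>} (\<lambda>t. arccos (g t))"
      using g_le g_nonneg by (intro continuous_on_arccos) (auto intro: order_trans[of _ 0])
    \<comment> \<open>At the left endpoint \<open>g\<close> is 1, where \<open>arccos\<close> is
      continuous but not differentiable; hence the interior form of the fundamental theorem. It also
      yields the integrability of \<theta>.\<close>
    ultimately have "(\<theta> has_integral arccos (g \<tau>) - arccos (g 0)) {0..\<tau>}"
      using \<open>0 < \<tau>\<close> by (intro fundamental_theorem_of_calculus_interior) auto
    moreover have "((\<lambda>t. 1/2 * (sqrt (A t) / t)) has_integral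
        1/2 * integral {0..\<tau>} (\<lambda>t. sqrt (A t) / t)) {0..\<tau>}"
      by (intro has_integral_mult_right integrable_integral int)
    ultimately have "arccos (g \<tau>) - arccos (g 0) \<le> 1/2 * integral {0..\<tau>} (\<lambda>t. sqrt (A t) / t)"
      by (rule has_integral_le) (use bound in auto)
    then show ?thesis by (simp add: g_0) (simp add: g_def)
  qed
qed

section \<open>The exponential of a hermitian matrix\<close>

lemma cscale_nth [simp]: "cscale c A $ i $ j = c * A $ i $ j"
  by (simp add: cscale_def)

lemma cscale_mult:
  "cscale c (A ** B) = cscale c A ** B" "cscale c (A ** B) = A ** cscale c B"
  by (simp_all add: vec_eq_iff matrix_matrix_mult_def sum_distrib_left mult_ac)

lemma bounded_linear_cscale: "bounded_linear (\<lambda>c. cscale c A)"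
  by (auto intro!: linear_conv_bounded_linear[THEN iffD1] linearI simp: vec_eq_iff algebra_simps)

text \<open>As a finite sum of linear images of the entries, a diagonal matrix inherits series and
  derivatives from its entries.\<close>

lemma diag_matrix_eq_sum:
  "diag_matrix d = (\<Sum>l\<in>UNIV. cscale (d l) (\<chi> i j. if i = l \<and> j = l then 1 else 0))"
proof -
  have "(\<Sum>l\<in>UNIV. d l * (if i = l \<and> j = l then 1 else 0)) 
      = (\<Sum>l\<in>UNIV. if i = l then if j = l then d l else 0 else 0)"
    for i j by (intro sum.cong) auto
  then show ?thesis
    by (simp add: vec_eq_iff sum_component diag_matrix_def)
qed

lemma diag_matrix_sums:
  assumes "\<And>i. (\<lambda>k. d k i) sums s i"
  shows "(\<lambda>k. diag_matrix (d k)) sums diag_matrix s"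
  unfolding diag_matrix_eq_sum
  by (intro sums_sum bounded_linear.sums[OF bounded_linear_cscale] assms)

lemma has_vector_derivative_diag_matrix:
  assumes "\<And>i. ((\<lambda>t. d t i) has_vector_derivative d' i) F"
  shows "((\<lambda>t. diag_matrix (d t)) has_vector_derivative diag_matrix d') F"
  unfolding diag_matrix_eq_sum
  by (intro has_vector_derivative_sum bounded_linear.has_vector_derivative[OF bounded_linear_cscale] assms)

lemma bounded_linear_sandwich:
  fixes A B :: "'n::finite cmatrix"
  shows "bounded_linear (\<lambda>X. A ** X ** B)"
  using bounded_linear_compose[OF matrix_mult.bounded_linear_left[of B]
      matrix_mult.bounded_linear_right[of A]] by simp

lemma mpow_unitary_diag:
  assumes "unitary U"
  shows "mpow (U ** diag_matrix c ** dagger U) k = U ** diag_matrix (\<lambda>i. c i ^ k) ** dagger U"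
proof (induction k)
  case 0
  have "diag_matrix (\<lambda>_. 1) = (mat 1 :: 'a cmatrix)" by (simp add: diag_matrix_def mat_def)
  then show ?case by (simp add: unitaryD[OF assms])
next
  case (Suc k)
  have "U ** diag_matrix c ** dagger U ** (U ** diag_matrix (\<lambda>i. c i ^ k) ** dagger U)
      = U ** (diag_matrix c ** diag_matrix (\<lambda>i. c i ^ k)) ** dagger U"
    by (simp add: matrix_mul_assoc unitary_cancel[OF assms])
  then show ?case by (simp add: Suc diag_matrix_mult)
qed

lemma mexp_unitary_diag:
  assumes "unitary U"
  shows "mexp (U ** diag_matrix c ** dagger U) = U ** diag_matrix (\<lambda>i. exp (c i)) ** dagger U"
proof -
  have "(\<lambda>k. diag_matrix (\<lambda>i. (1 / fact k :: real) *\<^sub>R c i ^ k)) sums diag_matrix (\<lambda>i. exp (c i))"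
    by (rule diag_matrix_sums) (use exp_converges in \<open>simp add: divide_inverse\<close>)
  then have "(\<lambda>k. U ** diag_matrix (\<lambda>i. (1 / fact k :: real) *\<^sub>R c i ^ k) ** dagger U)
      sums (U ** diag_matrix (\<lambda>i. exp (c i)) ** dagger U)"
    by (rule bounded_linear.sums[OF bounded_linear_sandwich])
  moreover have "diag_matrix (\<lambda>i. r *\<^sub>R f i) = r *\<^sub>R diag_matrix f" for r :: real and f :: "'a \<Rightarrow> complex"
    by (simp add: vec_eq_iff diag_matrix_def)
  ultimately show ?thesis
    by (simp add: mexp_def mpow_unitary_diag[OF assms] matrix_mult.scaleR_left matrix_mult.scaleR_right
        sums_unique[symmetric])
qed

lemma cscale_unitary_diag:
  "cscale z (U ** diag_matrix d ** dagger U) = U ** diag_matrix (\<lambda>i. z * d i) ** dagger U"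
proof -
  have "cscale z (diag_matrix d) = diag_matrix (\<lambda>i. z * d i)"
    by (simp add: vec_eq_iff) (simp add: diag_matrix_def)
  then show ?thesis by (metis cscale_mult)
qed

lemma mexp_cscale_unitary_diag:
  assumes "unitary U"
  shows "mexp (cscale z (U ** diag_matrix d ** dagger U)) =
    U ** diag_matrix (\<lambda>i. exp (z * d i)) ** dagger U"
  using assms by (simp add: cscale_unitary_diag mexp_unitary_diag)

section \<open>The exponentials \<open>mexp (cscale z A)\<close> of a hermitian matrix, by
  diagonalisation\<close>

context
  fixes A :: "'n::finite cmatrix"
  assumes herm: "hermitian A"
begin

lemma mexp_cscale_0: "mexp (cscale 0 A) = mat 1"
proof -
  obtain U d where U: "unitary U"
    and A: "A = U ** diag_matrix (\<lambda>i. complex_of_real (d i)) ** dagger U"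
    using hermitian_spectral[OF herm] .
  have "diag_matrix (\<lambda>_. 1) = (mat 1 :: 'n cmatrix)" by (simp add: diag_matrix_def mat_def)
  then show ?thesis by (simp add: A mexp_cscale_unitary_diag[OF U] unitaryD[OF U])
qed

lemma mexp_cscale_add: "mexp (cscale z A) ** mexp (cscale w A) = mexp (cscale (z + w) A)"
proof -
  obtain U d where U: "unitary U"
    and A: "A = U ** diag_matrix (\<lambda>i. complex_of_real (d i)) ** dagger U"
    using hermitian_spectral[OF herm] .
  have "U ** X ** dagger U ** (U ** Y ** dagger U) = U ** (X ** Y) ** dagger U" for X Y
    by (simp add: matrix_mul_assoc unitary_cancel[OF U])
  then show ?thesis
    by (simp add: A mexp_cscale_unitary_diag[OF U] diag_matrix_mult exp_add distrib_right)
qed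

lemma dagger_mexp_cscale: "dagger (mexp (cscale z A)) = mexp (cscale (cnj z) A)"
proof -
  obtain U d where U: "unitary U"
    and A: "A = U ** diag_matrix (\<lambda>i. complex_of_real (d i)) ** dagger U"
    using hermitian_spectral[OF herm] .
  show ?thesis
    by (simp add: A mexp_cscale_unitary_diag[OF U] dagger_mult dagger_diag_matrix exp_cnj matrix_mul_assoc)
qed

lemma unitary_mexp_imaginary: "cnj z = - z \<Longrightarrow> unitary (mexp (cscale z A))"
  by (simp add: unitary_def dagger_mexp_cscale mexp_cscale_add mexp_cscale_0)

text \<open>In an eigenbasis of \<open>A\<close>, a commuting matrix has nonzero entries only
  between equal eigenvalues, and there the exponentials agree as well.\<close>

lemma mexp_cscale_commute:
  assumes "B ** A = A ** B"
  shows "B ** mexp (cscale z A) = mexp (cscale z A) ** B"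
proof -
  obtain U d where U: "unitary U"
    and A: "A = U ** diag_matrix (\<lambda>i. complex_of_real (d i)) ** dagger U"
    using hermitian_spectral[OF herm] .
  define C where "C = dagger U ** B ** U"
  have B: "B = U ** C ** dagger U"
    by (simp add: C_def matrix_mul_assoc unitary_cancel[OF U] unitaryD[OF U])
  have conj: "U ** X ** dagger U ** (U ** Y ** dagger U) = U ** (X ** Y) ** dagger U" for X Y
    by (simp add: matrix_mul_assoc unitary_cancel[OF U])
  have inj: "X = Y" if "U ** X ** dagger U = U ** Y ** dagger U" for X Y
    by (metis that matrix_mul_assoc unitary_cancel(2,3)[OF U] unitaryD[OF U] matrix_mul_rid)
  have "C ** diag_matrix (\<lambda>i. complex_of_real (d i)) = diag_matrix (\<lambda>i. complex_of_real (d i)) ** C"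
    using assms unfolding A B conj by (rule inj)
  then have eq: "C $ i $ j * of_real (d j) = of_real (d i) * C $ i $ j" for i j
    by (metis diag_matrix_mult_nth)
  have "C $ i $ j * exp (z * of_real (d j)) = exp (z * of_real (d i)) * C $ i $ j" for i j
    using eq[of i j] by (cases "C $ i $ j = 0") auto
  then have "C ** diag_matrix (\<lambda>i. exp (z * of_real (d i))) = diag_matrix (\<lambda>i. exp (z * of_real (d i))) ** C"
    by (simp add: vec_eq_iff)
  then show ?thesis
    unfolding A B mexp_cscale_unitary_diag[OF U] conj by simp
qed

lemma has_vector_derivative_mexp:
  "((\<lambda>t. mexp (cscale (of_real t * z) A)) has_vector_derivative
    mexp (cscale (of_real t * z) A) ** cscale z A) (at t within S)"
proof -
  obtain U d where U: "unitary U"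
    and A: "A = U ** diag_matrix (\<lambda>i. complex_of_real (d i)) ** dagger U"
    using hermitian_spectral[OF herm] .
  have conj: "U ** X ** dagger U ** (U ** Y ** dagger U) = U ** (X ** Y) ** dagger U" for X Y
    by (simp add: matrix_mul_assoc unitary_cancel[OF U])
  have "((\<lambda>t. exp (of_real t * c)) has_vector_derivative exp (of_real t * c) * c) (at t within S)" for c :: complex
    using exp_scaleR_has_vector_derivative_right[of c t S]
    by (simp add: scaleR_conv_of_real)
  then have "((\<lambda>t. exp (of_real t * z * of_real (d i))) has_vector_derivative
      exp (of_real t * z * of_real (d i)) * (z * of_real (d i))) (at t within S)" for i
    by (simp add: mult.assoc)
  then show ?thesis
    unfolding A cscale_unitary_diag mexp_unitary_diag[OF U] conj diag_matrix_mult
    by (intro bounded_linear.has_vector_derivative[OF bounded_linear_sandwich]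
        has_vector_derivative_diag_matrix)
qed

end

section \<open>The Lindblad evolution\<close>

text \<open>The increment is the integral of the derivative. Taking adjoints and evaluating a
  quadratic form are bounded linear, so both conditions for positivity pass through the
  integral.\<close>

lemma psd_increment:
  fixes Z Z' :: "real \<Rightarrow> 'n::finite cmatrix"
  assumes "0 \<le> T"
    and deriv: "\<And>t. t \<in> {0..T} \<Longrightarrow> (Z has_vector_derivative Z' t) (at t within {0..T})"
    and psd: "\<And>t. t \<in> {0..T} \<Longrightarrow> psd (Z' t)"
  shows "psd (Z T - Z 0)"
proof -
  have int: "(Z' has_integral Z T - Z 0) {0..T}"
    using assms by (intro fundamental_theorem_of_calculus) auto
  have "((\<lambda>t. dagger (Z' t)) has_integral dagger (Z T - Z 0)) {0..T}"
    using has_integral_linear[OF int bounded_linear_dagger] by (simp add: o_def)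
  moreover have "dagger (Z' t) = Z' t" if "t \<in> {0..T}" for t
    using psdD(1)[OF psd[OF that]] by (simp add: hermitian_def)
  ultimately have "(Z' has_integral dagger (Z T - Z 0)) {0..T}"
    by (rule has_integral_eq[rotated])
  then have "hermitian (Z T - Z 0)"
    unfolding hermitian_def by (rule has_integral_unique[OF _ int])
  moreover have "0 \<le> x \<bullet> ((Z T - Z 0) *v x)" for x
  proof -
    from has_integral_linear[OF int bounded_linear_quadratic_form]
    have "((\<lambda>t. x \<bullet> (Z' t *v x)) has_integral x \<bullet> ((Z T - Z 0) *v x)) {0..T}"
      by (simp add: o_def)
    then show ?thesis
      by (rule has_integral_nonneg) (simp add: psd psdD)
  qed
  ultimately show ?thesis by (simp add: psd_iff)
qed

text \<open>The trace of a function of a diagonalised operator against \<rho> is a weighted sum over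
  the spectrum, with the diagonal of \<rho> in the eigenbasis as weights.\<close>

lemma trace_unitary_diag_mult:
  fixes U \<rho> :: "'n::finite cmatrix"
  shows "Re (trace (U ** diag_matrix (\<lambda>i. of_real (f i)) ** dagger U ** \<rho>))
    = (\<Sum>i\<in>UNIV. Re ((dagger U ** \<rho> ** U) $ i $ i) * f i)"
proof -
  have "trace (U ** diag_matrix (\<lambda>i. of_real (f i)) ** dagger U ** \<rho>)
      = trace (diag_matrix (\<lambda>i. of_real (f i)) ** (dagger U ** \<rho> ** U))"
    by (metis matrix_mul_assoc trace_mul_sym)
  also have "\<dots> = (\<Sum>i\<in>UNIV. of_real (f i) * (dagger U ** \<rho> ** U) $ i $ i)"
    by (simp add: trace_def)
  finally show ?thesis by (simp add: mult.commute)
qed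

section \<open>The master equation with jumps that shift the energy\<close>

locale lindblad =
  fixes H :: "'n::finite cmatrix" and L :: "nat \<Rightarrow> 'n cmatrix" and N :: nat
    and \<rho> :: "real \<Rightarrow> 'n cmatrix"
  assumes hermitian_H: "hermitian H"
    and density: "\<And>t. 0 \<le> t \<Longrightarrow> density_op (\<rho> t)"
    and master_equation:
      "\<And>t. 0 \<le> t \<Longrightarrow> (\<rho> has_vector_derivative lindbladian H N L (\<rho> t)) (at t within {0..})"
    and jump_frequency: "\<And>m. m \<in> {1..N} \<Longrightarrow> \<exists>w::real. commutator (L m) H = w *\<^sub>R L m"
begin

definition K :: "'n cmatrix" where
  "K = (\<Sum>m=1..N. dagger (L m) ** L m)"

definition jump :: "'n cmatrix \<Rightarrow> 'n cmatrix" where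
  "jump X = (\<Sum>m=1..N. L m ** X ** dagger (L m))"

text \<open>The evolution between jumps has effective Hamiltonian \<open>H - \<i> K / 2\<close>.
  Since \<open>K\<close> commutes with \<open>H\<close>, it factors, and this is the damping factor
  left in the interaction picture.\<close>

definition no_jump :: "real \<Rightarrow> 'n cmatrix" where
  "no_jump t = mexp (cscale (of_real (- t / 2)) K)"

lemma psd_K: "psd K"
  unfolding K_def by (intro psd_sum psd_dagger_mult)

lemma hermitian_K: "hermitian K"
  using psd_K by (rule psdD)

lemma psd_jump: "psd X \<Longrightarrow> psd (jump X)"
  unfolding jump_def by (intro psd_sum psd_congruence)

lemma trace_jump: "trace (jump X) = trace (K ** X)"
proof -
  have "trace (L m ** X ** dagger (L m)) = trace (dagger (L m) ** L m ** X)" for m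
    by (metis matrix_mul_assoc trace_mul_sym)
  then show ?thesis
    by (simp add: jump_def K_def matrix_mult.sum_left
        linear_sum[OF bounded_linear.linear[OF bounded_linear_trace]])
qed

text \<open>Taking the adjoint of the relation for \<open>L m\<close>, with \<open>w\<close> real
  and \<open>H\<close> hermitian, gives \<open>dagger (L m)\<close> the opposite energy shift. The
  two shifts cancel in each product \<open>dagger (L m) ** L m\<close>.\<close>

lemma K_commute: "K ** H = H ** K"
proof -
  have "dagger (L m) ** L m ** H = H ** (dagger (L m) ** L m)" if m: "m \<in> {1..N}" for m
  proof -
    obtain w :: real where "L m ** H - H ** L m = w *\<^sub>R L m"
      using jump_frequency[OF m] by (auto simp: commutator_def)
    then have LH: "L m ** H = H ** L m + w *\<^sub>R L m" by (simp add: algebra_simps)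
    then have "dagger (L m ** H) = dagger (H ** L m + w *\<^sub>R L m)" by simp
    then have "H ** dagger (L m) = dagger (L m) ** H + w *\<^sub>R dagger (L m)"
      using hermitian_H by (simp add: dagger_mult dagger_add dagger_scaleR hermitian_def)
    then have "H ** (dagger (L m) ** L m) = dagger (L m) ** (H ** L m) + w *\<^sub>R (dagger (L m) ** L m)"
      by (simp add: matrix_mul_assoc matrix_mult.add_left matrix_mult.scaleR_left)
    also have "\<dots> = dagger (L m) ** (L m ** H)"
      by (simp add: LH matrix_mult.add_right matrix_mult.scaleR_right)
    finally show ?thesis by (simp add: matrix_mul_assoc)
  qed
  then show ?thesis
    by (simp add: K_def matrix_mult.sum_left matrix_mult.sum_right)
qed

lemma lindbladian_eq:
  "lindbladian H N L X = cscale (- \<i>) (H ** X - X ** H) + jump X - (1/2 :: real) *\<^sub>R (K ** X + X ** K)"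
  by (simp add: lindbladian_def commutator_def anticommutator_def jump_def K_def sum_subtractf
      sum.distrib scaleR_sum_right[symmetric] matrix_mult.sum_left matrix_mult.sum_right)

lemma evolution_eq: "evolution H t = mexp (cscale (of_real t * - \<i>) H)"
  by (simp add: evolution_def mult.commute)

lemma dagger_evolution: "dagger (evolution H t) = mexp (cscale (of_real t * \<i>) H)"
  by (simp add: evolution_eq dagger_mexp_cscale[OF hermitian_H])

lemma unitary_evolution: "unitary (evolution H t)"
  unfolding evolution_eq by (rule unitary_mexp_imaginary[OF hermitian_H]) simp

text \<open>In the interaction picture the no-jump evolution can be undone: conjugation by
  \<open>exp (t K / 2) exp (i t H)\<close> removes every term of the generator except the positive one.\<close>

lemma interaction_picture_ge_no_jump:
  assumes "0 \<le> T"
  shows "psd (dagger (evolution H T) ** \<rho> T ** evolution H T - no_jump T ** \<rho> 0 ** dagger (no_jump T))"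
proof -
  define W where "W t = mexp (cscale (of_real t * (1/2)) K)" for t :: real
  define V where "V t = mexp (cscale (of_real t * \<i>) H)" for t :: real
  define G where "G = cscale (1/2) K + cscale \<i> H"
  define Z where "Z t = W t ** V t ** \<rho> t ** dagger (W t ** V t)" for t
  have W: "(W has_vector_derivative W t ** cscale (1/2) K) (at t within S)" for t S
    unfolding W_def by (rule has_vector_derivative_mexp[OF hermitian_K])
  have V: "(V has_vector_derivative V t ** cscale \<i> H) (at t within S)" for t S
    unfolding V_def by (rule has_vector_derivative_mexp[OF hermitian_H])
  have KV: "cscale (1/2) K ** V t = V t ** cscale (1/2) K" for t
    unfolding V_def
    by (metis K_commute cscale_mult mexp_cscale_commute[OF hermitian_H])
  have WV: "((\<lambda>t. W t ** V t) has_vector_derivative W t ** V t ** G) (at t within S)" for t S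
  proof -
    have "W t ** (V t ** cscale \<i> H) + W t ** cscale (1/2) K ** V t = W t ** V t ** G"
      by (simp add: G_def matrix_mult.add_right matrix_mul_assoc[symmetric] KV)
    then show ?thesis
      using matrix_mult.has_vector_derivative[OF W[of t S] V[of t S]] by simp
  qed
  have dagG: "dagger G = cscale (1/2) K + cscale (- \<i>) H"
  proof -
    have "dagger (cscale c A) = cscale (cnj c) (dagger A)" for c and A :: "'n cmatrix"
      by (simp add: vec_eq_iff)
    then show ?thesis
      using hermitian_H hermitian_K by (simp add: G_def dagger_add hermitian_def)
  qed
  have gen: "G ** X + lindbladian H N L X + X ** dagger G = jump X" for X
  proof -
    have "cscale (1/2) (K ** X) + cscale \<i> (H ** X) + lindbladian H N L X
        + (cscale (1/2) (X ** K) + cscale (- \<i>) (X ** H)) = jump X"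
      unfolding lindbladian_eq
      by (simp add: vec_eq_iff) (simp add: scaleR_conv_of_real algebra_simps)
    then show ?thesis
      unfolding dagG by (simp add: G_def matrix_mult.add_left matrix_mult.add_right cscale_mult(1))
        (metis cscale_mult)
  qed
  have Z': "(Z has_vector_derivative W t ** V t ** jump (\<rho> t) ** dagger (W t ** V t)) (at t within {0..T})"
    if "t \<in> {0..T}" for t
  proof -
    have \<rho>: "(\<rho> has_vector_derivative lindbladian H N L (\<rho> t)) (at t within {0..T})"
      using master_equation[of t] that
      by (auto intro: has_vector_derivative_within_subset)
    have "W t ** V t ** \<rho> t ** dagger (W t ** V t ** G)
        + (W t ** V t ** lindbladian H N L (\<rho> t) + W t ** V t ** G ** \<rho> t) ** dagger (W t ** V t)
        = W t ** V t ** (G ** \<rho> t + lindbladian H N L (\<rho> t) + \<rho> t ** dagger G) ** dagger (W t ** V t)"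
      by (simp add: dagger_mult[of "W t ** V t" G] matrix_mult.add_left matrix_mult.add_right
          matrix_mul_assoc)
    then show ?thesis
      unfolding Z_def
      using matrix_mult.has_vector_derivative[OF matrix_mult.has_vector_derivative[OF WV \<rho>]
          bounded_linear.has_vector_derivative[OF bounded_linear_dagger WV[of t "{0..T}"]]]
      by (simp add: gen)
  qed
  have "psd (Z T - Z 0)"
  proof (rule psd_increment[OF assms Z'])
    fix t assume "t \<in> {0..T}"
    then show "psd (W t ** V t ** jump (\<rho> t) ** dagger (W t ** V t))"
      by (intro psd_congruence psd_jump density_opD density) auto
  qed
  \<comment> \<open>Since \<open>no_jump T\<close> is inverse to \<open>W T\<close>, this
    conjugation turns \<open>Z T\<close> into the interaction picture state and \<open>Z 0\<close>,
    which is the initial state, into its no-jump part.\<close>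
  then have "psd (no_jump T ** (Z T - Z 0) ** dagger (no_jump T))"
    by (rule psd_congruence)
  moreover have "Z 0 = \<rho> 0"
    by (simp add: Z_def W_def V_def mexp_cscale_0[OF hermitian_H] mexp_cscale_0[OF hermitian_K])
  moreover have "no_jump T ** Z T ** dagger (no_jump T) = V T ** \<rho> T ** dagger (V T)"
  proof -
    have MW: "no_jump T ** W T = mat 1"
      by (simp add: no_jump_def W_def mexp_cscale_add[OF hermitian_K] mexp_cscale_0[OF hermitian_K])
    then have "dagger (W T) ** dagger (no_jump T) = mat 1"
      by (metis dagger_mult dagger_mat_1)
    with MW show ?thesis
      by (simp add: Z_def dagger_mult matrix_mul_assoc) (simp add: matrix_mul_assoc[symmetric])
  qed
  moreover have "V T = dagger (evolution H T)" by (simp add: V_def dagger_evolution)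
  ultimately show ?thesis
    by (simp add: matrix_mult.diff_left matrix_mult.diff_right)
qed

lemma activity_eq: "activity N L \<rho> t = integral {0..t} (\<lambda>s. Re (trace (K ** \<rho> s)))"
proof -
  have "(\<Sum>m=1..N. Re (trace (L m ** X ** dagger (L m)))) = Re (trace (K ** X))" for X
    unfolding trace_jump[symmetric] jump_def
    by (simp add: linear_sum[OF bounded_linear.linear[OF bounded_linear_trace]])
  then show ?thesis by (simp add: activity_def)
qed

text \<open>The trace against \<open>K\<close> is the trace of \<open>jump\<close>, a map that
  preserves positivity.\<close>

lemma trace_K_mono: "psd (X - Y) \<Longrightarrow> Re (trace (K ** Y)) \<le> Re (trace (K ** X))"
  using psd_trace_nonneg[OF psd_jump, of "X - Y"]
  by (simp add: trace_jump matrix_mult.diff_right trace_sub)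

text \<open>\<open>K\<close> commutes with the free evolution, so the jump rate may be computed in
  the interaction picture, where the comparison with the no-jump part holds.\<close>

lemma trace_K_interaction_picture:
  "trace (K ** (dagger (evolution H t) ** X ** evolution H t)) = trace (K ** X)"
proof -
  have "K ** dagger (evolution H t) = dagger (evolution H t) ** K"
    unfolding dagger_evolution by (rule mexp_cscale_commute[OF hermitian_H K_commute])
  then have "K ** (dagger (evolution H t) ** X ** evolution H t)
      = dagger (evolution H t) ** (K ** X) ** dagger (dagger (evolution H t))"
    by (simp add: matrix_mul_assoc)
  then show ?thesis
    by (simp only: trace_conj_unitary[OF unitary_dagger[OF unitary_evolution]])
qed

lemma bures_angle_le_activity_integral:
  assumes "0 < \<tau>" and int: "(\<lambda>t. sqrt (activity N L \<rho> t) / t) integrable_on {0..\<tau>}"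
  shows "bures_angle (\<rho> 0) (dagger (evolution H \<tau>) ** \<rho> \<tau> ** evolution H \<tau>)
    \<le> 1/2 * integral {0..\<tau>} (\<lambda>t. sqrt (activity N L \<rho> t) / t)"
proof -
  obtain U k where U: "unitary U" and k: "\<forall>i. 0 \<le> k i"
    and K: "K = U ** diag_matrix (\<lambda>i. complex_of_real (k i)) ** dagger U"
    by (rule psd_spectral[OF psd_K])
  \<comment> \<open>These weights are the spectral distribution of \<open>K\<close> in the initial
    state; they are nonnegative and sum to 1.\<close>
  define p where "p i = Re ((dagger U ** \<rho> 0 ** U) $ i $ i)" for i
  note \<rho>0 = density_opD[OF density[of 0, OF order_refl]]
  have "psd (dagger U ** \<rho> 0 ** U)" using psd_congruence[OF \<rho>0(1), of "dagger U"] by simp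
  then have p_nonneg: "0 \<le> p i" for i unfolding p_def by (rule psd_diag)
  have "trace (dagger U ** \<rho> 0 ** U) = 1"
    using trace_conj_unitary[OF unitary_dagger[OF U], of "\<rho> 0"] \<rho>0(2) by simp
  then have p_sum: "sum p UNIV = 1"
    unfolding p_def by (metis Re_sum one_complex.sel(1) trace_def)
  have no_jump: "no_jump t = U ** diag_matrix (\<lambda>i. of_real (exp (- t / 2 * k i))) ** dagger U" for t
    unfolding no_jump_def K mexp_cscale_unitary_diag[OF U] of_real_mult[symmetric] exp_of_real ..
  have no_jump_trace: "Re (trace (no_jump t ** \<rho> 0)) = (\<Sum>i\<in>UNIV. p i * exp (- t / 2 * k i))" for t
    unfolding no_jump trace_unitary_diag_mult p_def ..
  \<comment> \<open>The left side is the jump rate of the no-jump part alone, which the full state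
    dominates in the interaction picture.\<close>
  have rate: "(\<Sum>i\<in>UNIV. p i * (k i * exp (- t * k i))) \<le> Re (trace (K ** \<rho> t))" if "0 \<le> t" for t
  proof -
    have "trace (K ** (no_jump t ** \<rho> 0 ** dagger (no_jump t)))
        = trace (dagger (no_jump t) ** K ** no_jump t ** \<rho> 0)"
      by (metis matrix_mul_assoc trace_mul_sym)
    also have "dagger (no_jump t) ** K ** no_jump t
        = U ** diag_matrix (\<lambda>i. of_real (k i * exp (- t * k i))) ** dagger U"
    proof -
      have exp2: "exp (- t / 2 * k i) * k i * exp (- t / 2 * k i) = k i * exp (- t * k i)" for i
        by (simp flip: exp_add)
      have "dagger (no_jump t) ** K ** no_jump t = U ** (diag_matrix (\<lambda>i. of_real (exp (- t / 2 * k i)))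
          ** diag_matrix (\<lambda>i. of_real (k i)) ** diag_matrix (\<lambda>i. of_real (exp (- t / 2 * k i)))) ** dagger U"
        by (simp add: K no_jump dagger_mult dagger_diag_matrix matrix_mul_assoc unitary_cancel[OF U]
            del: of_real_mult)
      then show ?thesis
        unfolding diag_matrix_mult of_real_mult[symmetric] exp2 .
    qed
    finally have "(\<Sum>i\<in>UNIV. p i * (k i * exp (- t * k i)))
        = Re (trace (K ** (no_jump t ** \<rho> 0 ** dagger (no_jump t))))"
      unfolding p_def by (simp only: trace_unitary_diag_mult)
    also have "\<dots> \<le> Re (trace (K ** (dagger (evolution H t) ** \<rho> t ** evolution H t)))"
      by (rule trace_K_mono[OF interaction_picture_ge_no_jump[OF that]])
    finally show ?thesis by (simp only: trace_K_interaction_picture)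
  qed
  have activity_ge: "1 - (\<Sum>i\<in>UNIV. p i * exp (- t * k i)) \<le> activity N L \<rho> t" if "0 \<le> t" for t
  proof -
    \<comment> \<open>Up to sign this is the trace of the no-jump part at time \<open>s\<close>; its
      derivative is the lower bound in \<open>rate\<close>, and \<open>a 0 = - 1\<close>.\<close>
    define a where "a s = - (\<Sum>i\<in>UNIV. p i * exp (- s * k i))" for s
    have "((\<lambda>s. \<Sum>i\<in>UNIV. p i * (k i * exp (- s * k i))) has_integral a t - a 0) {0..t}"
    proof (rule fundamental_theorem_of_calculus[OF that])
      fix s
      have "(a has_real_derivative (\<Sum>i\<in>UNIV. p i * (k i * exp (- s * k i)))) (at s within {0..t})"
        unfolding a_def
        by (auto intro!: derivative_eq_intros simp: sum_negf[symmetric] algebra_simps)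
      then show "(a has_vector_derivative (\<Sum>i\<in>UNIV. p i * (k i * exp (- s * k i)))) (at s within {0..t})"
        by (simp add: has_real_derivative_iff_has_vector_derivative)
    qed
    moreover have "continuous_on {0..} \<rho>"
      using master_equation
      by (auto simp: continuous_on_eq_continuous_within intro: has_vector_derivative_continuous)
    then have "continuous_on {0..t} \<rho>" by (rule continuous_on_subset) auto
    then have "(\<lambda>s. Re (trace (K ** \<rho> s))) integrable_on {0..t}"
      by (intro integrable_continuous_real continuous_intros)
    then have "((\<lambda>s. Re (trace (K ** \<rho> s))) has_integral activity N L \<rho> t) {0..t}"
      unfolding activity_eq by (rule integrable_integral)
    ultimately have "a t - a 0 \<le> activity N L \<rho> t"
      by (rule has_integral_le) (use rate in auto)
    then show ?thesis by (simp add: a_def p_sum)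
  qed
  let ?\<sigma> = "dagger (evolution H \<tau>) ** \<rho> \<tau> ** evolution H \<tau>"
  have \<sigma>: "density_op ?\<sigma>"
    using density_op_unitary_conj[OF density unitary_dagger[OF unitary_evolution], of \<tau> \<tau>] assms(1)
    by simp
  have "Re (trace (no_jump \<tau> ** \<rho> 0)) \<le> sqrt (fidelity (\<rho> 0) ?\<sigma>)"
    using \<rho>0(1) density_opD(1)[OF \<sigma>] interaction_picture_ge_no_jump[of \<tau>] assms(1)
    by (intro trace_le_sqrt_fidelity) auto
  then have "bures_angle (\<rho> 0) ?\<sigma> \<le> arccos (Re (trace (no_jump \<tau> ** \<rho> 0)))"
    unfolding bures_angle_def
  proof (rule arccos_le_arccos[rotated])
    show "sqrt (fidelity (\<rho> 0) ?\<sigma>) \<le> 1" by (rule sqrt_fidelity_le_1[OF density[of 0] \<sigma>]) simp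
    have "0 \<le> Re (trace (no_jump \<tau> ** \<rho> 0))"
      unfolding no_jump_trace by (intro sum_nonneg) (simp add: p_nonneg)
    then show "- 1 \<le> Re (trace (no_jump \<tau> ** \<rho> 0))" by simp
  qed
  also have "\<dots> \<le> 1/2 * integral {0..\<tau>} (\<lambda>t. sqrt (activity N L \<rho> t) / t)"
    unfolding no_jump_trace
    by (rule arccos_exp_mean_le_integral[OF p_nonneg p_sum _ assms(1) activity_ge int]) (use k in auto)
  finally show ?thesis .
qed

lemma bures_angle_orbit_le_interaction_picture:
  assumes "0 \<le> \<tau>"
  shows "bures_angle_orbit (\<rho> 0) (\<rho> \<tau>)
    \<le> bures_angle (\<rho> 0) (dagger (evolution H \<tau>) ** \<rho> \<tau> ** evolution H \<tau>)"
proof -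
  have "bures_angle_orbit (\<rho> 0) (\<rho> \<tau>)
      \<le> bures_angle (evolution H \<tau> ** \<rho> 0 ** dagger (evolution H \<tau>)) (\<rho> \<tau>)"
    using assms by (intro bures_angle_orbit_le density unitary_evolution) auto
  also have "\<dots> = bures_angle (\<rho> 0) (dagger (evolution H \<tau>) ** \<rho> \<tau> ** evolution H \<tau>)"
    using assms by (intro bures_angle_unitary_conj density_opD(1) density unitary_evolution) auto
  finally show ?thesis .
qed

end

theorem mainTheorem10:
  fixes H :: "complex ^ 'n::finite ^ 'n"
    and L :: "nat \<Rightarrow> complex ^ 'n ^ 'n"
    and N :: nat
    and \<rho> :: "real \<Rightarrow> complex ^ 'n ^ 'n"
    and \<tau> :: real
  assumes "hermitian H"
    and "\<And>t. t \<ge> 0 \<Longrightarrow> density_op (\<rho> t)"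
    and "\<And>t. t \<ge> 0 \<Longrightarrow>
           (\<rho> has_vector_derivative lindbladian H N L (\<rho> t)) (at t within {0..})"
    and "\<And>m. m \<in> {1..N} \<Longrightarrow> \<exists>w::real. commutator (L m) H = w *\<^sub>R L m"
    and "\<tau> > 0"
    and "0 < 1/2 * integral {0..\<tau>} (\<lambda>t. sqrt (activity N L \<rho> t) / t)"
    and "1/2 * integral {0..\<tau>} (\<lambda>t. sqrt (activity N L \<rho> t) / t) \<le> pi / 2"
  shows "\<tau> \<ge> 2 * bures_angle (\<rho> 0) (dagger (evolution H \<tau>) ** \<rho> \<tau> ** evolution H \<tau>)
             / (1 / \<tau> * integral {0..\<tau>} (\<lambda>t. sqrt (activity N L \<rho> t) / t))
       \<and> 2 * bures_angle (\<rho> 0) (dagger (evolution H \<tau>) ** \<rho> \<tau> ** evolution H \<tau>)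
             / (1 / \<tau> * integral {0..\<tau>} (\<lambda>t. sqrt (activity N L \<rho> t) / t))
         \<ge> 2 * bures_angle_orbit (\<rho> 0) (\<rho> \<tau>)
             / (1 / \<tau> * integral {0..\<tau>} (\<lambda>t. sqrt (activity N L \<rho> t) / t))"
proof -
  interpret lindblad H L N \<rho>
    using assms(1-4) by unfold_locales auto
  let ?B = "bures_angle (\<rho> 0) (dagger (evolution H \<tau>) ** \<rho> \<tau> ** evolution H \<tau>)"
  let ?I = "integral {0..\<tau>} (\<lambda>t. sqrt (activity N L \<rho> t) / t)"
  have "?I > 0" using assms(6) by simp
  \<comment> \<open>A non-integrable function has integral 0 by default, so the positive value of
    \<open>?I\<close> forces integrability despite the singular factor at 0.\<close>
  then have int: "(\<lambda>t. sqrt (activity N L \<rho> t) / t) integrable_on {0..\<tau>}"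
    using not_integrable_integral by fastforce
  have "?B \<le> 1/2 * ?I"
    by (rule bures_angle_le_activity_integral[OF assms(5) int])
  then have "2 * ?B / (1 / \<tau> * ?I) \<le> \<tau>"
    using \<open>?I > 0\<close> assms(5) by (simp add: field_simps)
  moreover have "2 * bures_angle_orbit (\<rho> 0) (\<rho> \<tau>) / (1 / \<tau> * ?I) \<le> 2 * ?B / (1 / \<tau> * ?I)"
    using \<open>?I > 0\<close> assms(5) bures_angle_orbit_le_interaction_picture[of \<tau>]
    by (intro divide_right_mono mult_left_mono) auto
  ultimately show ?thesis by blast
qed

end
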